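(* Let $\mathcal{A}_1,\dots,\mathcal{A}_n$ be finite labelled transition systems, $\mathbf{A}=\mathcal{A}_1\parallel\cdots\parallel\mathcal{A}_n$, with interface $\mathcal{A}_i$ (no non-divergence assumption). Every run of Algorithm 2 (for every choice of the order in which possible extensions are added) terminates and returns a finite branching process $\mathcal{N}$ of $\mathbf{A}$ such that the folding $\mathcal{S}_i$ of the interface projection $\mathcal{N}_i$ satisfies $\mathrm{Tr}(\mathcal{S}_i)=\mathrm{Tr}(\mathbf{A})|_{\Sigma_i}$, i.e. $\mathcal{S}_i$ is a summary of $\mathbf{A}$.
   Context: A labelled transition system (LTS) is $\mathcal{A}=(\Sigma,S,T,\lambda,s^0)$ with finite actions, finite states, $T\subseteq S\times S$, $\lambda:T\to\Sigma$, initial state $s^0$. An execution is a finite or infinite sequence $t_1t_2\dots$ of transitions with $t_k=(s_{k-1},s_k)$; a history is one with $s_0=s^0$; a trace is the label sequence of a history; $\mathrm{Tr}(\mathcal{A})$ is the set of (finite and infinite) traces. For $\mathcal{A}_j=(\Sigma_j,S_j,T_j,\lambda_j,s^0_j)$, $\mathbf{A}=\mathcal{A}_1\parallel\cdots\parallel\mathcal{A}_n$ has actions $\bigcup_j\Sigma_j$, global states in $S_1\times\cdots\times S_n$, initial state $(s^0_1,\dots,s^0_n)$, and global transitions $\mathbf{t}=(t_1,\dots,t_n)\ne(\star,\dots,\star)$ with label $a$ where $t_j$ is an $a$-transition of $\mathcal{A}_j$ if $a\in\Sigma_j$ and $t_j=\star$ otherwise ($\mathcal{A}_j$ moves along $t_j$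 if $t_j\ne\star$, else stays; it participates iff $t_j\neq\star$). ${}^\bullet\mathbf{t}$ / $\mathbf{t}^\bullet$ are the source / target states of the $t_j\ne\star$. $X|_{\Sigma_i}$ denotes projections of traces in $X$ onto $\Sigma_i$. Branching processes: Petri nets with conditions labelled by local states and events labelled by global transitions (hence actions), defined inductively: the net with conditions $b^0_1,\dots,b^0_n$ labelled $s^0_1,\dots,s^0_n$, no events, initial marking $\{b^0_1,\dots,b^0_n\}$ is one; if a reachable marking of $\mathcal{N}$ contains a set $M$ of conditions labelled exactly by ${}^\bullet\mathbf{t}$ and no event labelled $\mathbf{t}$ has input set $M$, then adding an event $e$ labelled $\mathbf{t}$ with inputs $M$ and a fresh output condition labelled $s$ for each $s\in\mathbf{t}^\bullet$ yields a branching process ($e$ is a possible extension of $\mathcal{N}$). $x<y$: nonempty arc path from $x$ to $y$. Conflict: some condition $z\ne x,y$ from which both are reachable leaving $z$ by different arcs. Concurrent: neither causally related ($\le$ either way) nor in conflict. $[e]=\{e':e'\le e\}$; $M(e)$: marking reached by firing exactly $[e]$; $M(e)_j$: its condition labelled by a state of $\mathcal{A}_j$; $\mathrm{St}(e)$: the global state of labels of $M(e)$. An $i$-event is one in which $\mathcal{A}_i$ participates; $ip(e)=M(e)_i$. Strong cause: $e'\ll e$ iff $e'<e$ and $b'<b$ for all $b\in M(e)\setminus M(e')$, $b'\in M(e')\setminus M(e)$. Cut-offs and candidates (relative to the current process $\mathcal{N}$, for a new event $e$): $\mathrm{Con}_i(\mathcal{N},e)$ is the set of $i$-events of $\mathcal{N}$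 that are not cut-offs and are concurrent with $e$. $e$ is a cut-off if it is an $i$-event and $\mathcal{N}$ contains an $i$-event $e'$ with $\mathrm{St}(e)=\mathrm{St}(e')$ ($e'$ is a companion). $e$ is a cut-off candidate of $\mathcal{N}$ if it is not an $i$-event and $\mathcal{N}$ contains $e'\ll e$ with $\mathrm{St}(e)=\mathrm{St}(e')$, $ip(e')=ip(e)$ and $\mathrm{Con}_i(\mathcal{N},e)\subseteq\mathrm{Con}_i(\mathcal{N},e')$. An event $e$ frees a cut-off candidate $e_c$ of $\mathcal{N}$ if $e_c$ is not a cut-off candidate of the branching process obtained by adding $e$ to $\mathcal{N}$. Algorithm 2: start with the branching process without events, $co=coc=\emptyset$. While there is a possible extension of $\mathcal{N}$ with no event of $co\cup coc$ in its causal past, choose any such $e$; if $e$ is a cut-off, add it to $co$; else if $e$ is a cut-off candidate of $\mathcal{N}$, add it to $coc$; else remove from $coc$ every $e'\in coc$ that $e$ frees; then add $e$ to $\mathcal{N}$. At termination, let $\equiv$ be the smallest equivalence on conditions labelled by states of $\mathcal{A}_i$ with $M(e)_i\equiv M(e')_i$ for every $e\in co$ with companion $e'$. Interface projection $\mathcal{N}_i$: LTS whose states are the conditions labelled by states of $\mathcal{A}_i$, initial state $b^0_i$, with a transition $(b,b')$ labelled $a$ for each $i$-event with action $a$, input $i$-condition $b$ and output $i$-condition $b'$. Its folding $\mathcal{S}_i$: states $[b]_\equiv$, initial state $[b^0_i]_\equiv$, a transition $([b]_\equiv,[b']_\equiv)$ labelled $a$ for each such transition of $\mathcal{N}_i$.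 *)

theory Defs
  imports Main "HOL-Library.FSet" "HOL-Library.Infinite_Set"
begin

record ('s, 'a) lts =
  acts  :: "'a set"
  states :: "'s set"
  trans :: "('s \<times> 's) set"
  lab   :: "'s \<times> 's \<Rightarrow> 'a"
  init  :: "'s"

definition lts_wf :: "('s, 'a) lts \<Rightarrow> bool" where
  "lts_wf L \<longleftrightarrow> finite (acts L) \<and> finite (states L) \<and> trans L \<subseteq> states L \<times> states L
      \<and> (\<forall>t\<in>trans L. lab L t \<in> acts L) \<and> init L \<in> states L"

datatype 'a fiseq = FinS "'a list" | InfS "nat \<Rightarrow> 'a"

definition traces :: "('q \<times> 'a \<times> 'q) set \<Rightarrow> 'q \<Rightarrow> 'a fiseq set" where
  "traces R q0 =
     {FinS w | w. \<exists>qs. length qs = Suc (length w) \<and> qs ! 0 = q0 \<and>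
                       (\<forall>k < length w. (qs ! k, w ! k, qs ! Suc k) \<in> R)}
   \<union> {InfS w | w. \<exists>qs. qs 0 = q0 \<and> (\<forall>k. (qs k, w k, qs (Suc k)) \<in> R)}"

definition lts_rel :: "('s, 'a) lts \<Rightarrow> ('s \<times> 'a \<times> 's) set" where
  "lts_rel L = {(s, lab L (s, s'), s') | s s'. (s, s') \<in> trans L}"

definition Tr :: "('s, 'a) lts \<Rightarrow> 'a fiseq set" where
  "Tr L = traces (lts_rel L) (init L)"

fun proj :: "'a set \<Rightarrow> 'a fiseq \<Rightarrow> 'a fiseq" where
  "proj \<Sigma> (FinS w) = FinS (filter (\<lambda>a. a \<in> \<Sigma>) w)"
| "proj \<Sigma> (InfS f) =
     (if finite {k. f k \<in> \<Sigma>}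
      then FinS (filter (\<lambda>a. a \<in> \<Sigma>) (map f [0..< (LEAST N. \<forall>k\<ge>N. f k \<notin> \<Sigma>)]))
      else InfS (\<lambda>k. f (Infinite_Set.enumerate {k. f k \<in> \<Sigma>} k)))"

text \<open>A global transition is an action a together with a tuple tt of local transitions,
  None standing for the idle symbol.\<close>
definition gtrans :: "(nat \<Rightarrow> ('s, 'a) lts) \<Rightarrow> nat \<Rightarrow> 'a \<Rightarrow> (nat \<Rightarrow> ('s \<times> 's) option) \<Rightarrow> bool" where
  "gtrans A n a tt \<longleftrightarrow>
     (\<forall>j<n. if a \<in> acts (A j)
            then (\<exists>t. tt j = Some t \<and> t \<in> trans (A j) \<and> lab (A j) t = a)
            else tt j = None)
   \<and> (\<forall>j\<ge>n. tt j = None) \<and> (\<exists>j<n. tt j \<noteq> None)"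

text \<open>Global states are functions nat => 's (only the components j < n matter).\<close>
definition prod_rel :: "(nat \<Rightarrow> ('s, 'a) lts) \<Rightarrow> nat \<Rightarrow> ((nat \<Rightarrow> 's) \<times> 'a \<times> (nat \<Rightarrow> 's)) set" where
  "prod_rel A n = {(g, a, g') | g a g' tt. gtrans A n a tt
       \<and> (\<forall>j. \<forall>t. tt j = Some t \<longrightarrow> g j = fst t)
       \<and> g' = (\<lambda>j. case tt j of None \<Rightarrow> g j | Some t \<Rightarrow> snd t)}"

definition prod_init :: "(nat \<Rightarrow> ('s, 'a) lts) \<Rightarrow> nat \<Rightarrow> nat \<Rightarrow> 's" where
  "prod_init A n = (\<lambda>j. init (A j))"

definition Tr_prod :: "(nat \<Rightarrow> ('s, 'a) lts) \<Rightarrow> nat \<Rightarrow> 'a fiseq set" where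
  "Tr_prod A n = traces (prod_rel A n) (prod_init A n)"

text \<open>Conditions: the initial conditions b0_j, and the output condition of an event for
  component j. Events: global transition (a, tt) together with the input set of conditions.\<close>
datatype ('s, 'a) cond = Init nat | Out "('s, 'a) event" nat
     and ('s, 'a) event = Ev 'a "nat \<Rightarrow> ('s \<times> 's) option" "('s, 'a) cond fset"

fun comp :: "('s, 'a) cond \<Rightarrow> nat" where
  "comp (Init j) = j"
| "comp (Out e j) = j"

fun ev_act :: "('s, 'a) event \<Rightarrow> 'a" where "ev_act (Ev a tt M) = a"
fun ev_tt :: "('s, 'a) event \<Rightarrow> nat \<Rightarrow> ('s \<times> 's) option" where "ev_tt (Ev a tt M) = tt"
fun pre :: "('s, 'a) event \<Rightarrow> ('s, 'a) cond set" where "pre (Ev a tt M) = fset M"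

fun clab :: "(nat \<Rightarrow> ('s, 'a) lts) \<Rightarrow> ('s, 'a) cond \<Rightarrow> 's" where
  "clab A (Init j) = init (A j)"
| "clab A (Out e j) = snd (the (ev_tt e j))"

definition post :: "('s, 'a) event \<Rightarrow> ('s, 'a) cond set" where
  "post e = {Out e j | j. ev_tt e j \<noteq> None}"

definition init_mark :: "nat \<Rightarrow> ('s, 'a) cond set" where
  "init_mark n = {Init j | j. j < n}"

definition conds :: "nat \<Rightarrow> ('s, 'a) event set \<Rightarrow> ('s, 'a) cond set" where
  "conds n E = init_mark n \<union> \<Union> (post ` E)"

inductive reach :: "nat \<Rightarrow> ('s, 'a) event set \<Rightarrow> ('s, 'a) cond set \<Rightarrow> bool"
  for n E where
  reach_init: "reach n E (init_mark n)"
| reach_fire: "reach n E Mk \<Longrightarrow> e \<in> E \<Longrightarrow> pre e \<subseteq> Mk \<Longrightarrow> reach n E ((Mk - pre e) \<union> post e)"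

definition labelled_by_pre :: "(nat \<Rightarrow> ('s, 'a) lts) \<Rightarrow> (nat \<Rightarrow> ('s \<times> 's) option) \<Rightarrow> ('s, 'a) cond set \<Rightarrow> bool" where
  "labelled_by_pre A tt M \<longleftrightarrow> comp ` M = {j. tt j \<noteq> None} \<and> inj_on comp M
      \<and> (\<forall>c\<in>M. clab A c = fst (the (tt (comp c))))"

definition poss_ext :: "(nat \<Rightarrow> ('s, 'a) lts) \<Rightarrow> nat \<Rightarrow> ('s, 'a) event set \<Rightarrow> ('s, 'a) event \<Rightarrow> bool" where
  "poss_ext A n E e \<longleftrightarrow> (\<exists>a tt M. e = Ev a tt M \<and> gtrans A n a tt
      \<and> (\<exists>Mk. reach n E Mk \<and> fset M \<subseteq> Mk) \<and> labelled_by_pre A tt (fset M)) \<and> e \<notin> E"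

inductive is_bp :: "(nat \<Rightarrow> ('s, 'a) lts) \<Rightarrow> nat \<Rightarrow> ('s, 'a) event set \<Rightarrow> bool"
  for A n where
  bp_empty: "is_bp A n {}"
| bp_ext: "is_bp A n E \<Longrightarrow> poss_ext A n E e \<Longrightarrow> is_bp A n (insert e E)"

type_synonym ('s, 'a) node = "('s, 'a) cond + ('s, 'a) event"

definition flow :: "('s, 'a) event set \<Rightarrow> (('s, 'a) node \<times> ('s, 'a) node) set" where
  "flow E = {(Inl c, Inr e) | c e. e \<in> E \<and> c \<in> pre e} \<union> {(Inr e, Inl c) | c e. e \<in> E \<and> c \<in> post e}"

definition less :: "('s, 'a) event set \<Rightarrow> ('s, 'a) node \<Rightarrow> ('s, 'a) node \<Rightarrow> bool" where
  "less E x y \<longleftrightarrow> (x, y) \<in> (flow E)\<^sup>+"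

definition leq :: "('s, 'a) event set \<Rightarrow> ('s, 'a) node \<Rightarrow> ('s, 'a) node \<Rightarrow> bool" where
  "leq E x y \<longleftrightarrow> (x, y) \<in> (flow E)\<^sup>*"

definition conflict :: "('s, 'a) event set \<Rightarrow> ('s, 'a) node \<Rightarrow> ('s, 'a) node \<Rightarrow> bool" where
  "conflict E x y \<longleftrightarrow> (\<exists>z e1 e2. e1 \<in> E \<and> e2 \<in> E \<and> e1 \<noteq> e2 \<and> z \<in> pre e1 \<and> z \<in> pre e2
       \<and> Inl z \<noteq> x \<and> Inl z \<noteq> y \<and> leq E (Inr e1) x \<and> leq E (Inr e2) y)"

definition concurrent :: "('s, 'a) event set \<Rightarrow> ('s, 'a) node \<Rightarrow> ('s, 'a) node \<Rightarrow> bool" where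
  "concurrent E x y \<longleftrightarrow> \<not> leq E x y \<and> \<not> leq E y x \<and> \<not> conflict E x y"

text \<open>Local configuration [e] and the marking M(e) reached by firing exactly [e].\<close>
definition cfg :: "('s, 'a) event set \<Rightarrow> ('s, 'a) event \<Rightarrow> ('s, 'a) event set" where
  "cfg E e = {e'\<in>E. leq E (Inr e') (Inr e)}"

definition mark :: "nat \<Rightarrow> ('s, 'a) event set \<Rightarrow> ('s, 'a) event \<Rightarrow> ('s, 'a) cond set" where
  "mark n E e = (init_mark n \<union> \<Union> (post ` cfg E e)) - \<Union> (pre ` cfg E e)"

definition mcond :: "nat \<Rightarrow> ('s, 'a) event set \<Rightarrow> ('s, 'a) event \<Rightarrow> nat \<Rightarrow> ('s, 'a) cond" where
  "mcond n E e j = (THE c. c \<in> mark n E e \<and> comp c = j)"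

definition St :: "(nat \<Rightarrow> ('s, 'a) lts) \<Rightarrow> nat \<Rightarrow> ('s, 'a) event set \<Rightarrow> ('s, 'a) event \<Rightarrow> 's list" where
  "St A n E e = map (\<lambda>j. clab A (mcond n E e j)) [0..<n]"

definition ievent :: "nat \<Rightarrow> ('s, 'a) event \<Rightarrow> bool" where
  "ievent i e \<longleftrightarrow> ev_tt e i \<noteq> None"

definition scause :: "nat \<Rightarrow> ('s, 'a) event set \<Rightarrow> ('s, 'a) event \<Rightarrow> ('s, 'a) event \<Rightarrow> bool" where
  "scause n E e' e \<longleftrightarrow> less E (Inr e') (Inr e) \<and>
     (\<forall>b \<in> mark n E e - mark n E e'. \<forall>b' \<in> mark n E e' - mark n E e. less E (Inl b') (Inl b))"

definition Con :: "nat \<Rightarrow> ('s, 'a) event set \<Rightarrow> ('s, 'a) event set \<Rightarrow> ('s, 'a) event \<Rightarrow> ('s, 'a) event set" where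
  "Con i E co e = {e'\<in>E. ievent i e' \<and> e' \<notin> co \<and> concurrent (insert e E) (Inr e') (Inr e)}"

definition is_cutoff :: "(nat \<Rightarrow> ('s, 'a) lts) \<Rightarrow> nat \<Rightarrow> nat \<Rightarrow> ('s, 'a) event set \<Rightarrow> ('s, 'a) event \<Rightarrow> bool" where
  "is_cutoff A n i E e \<longleftrightarrow> ievent i e \<and>
     (\<exists>e'\<in>E. ievent i e' \<and> St A n (insert e E) e = St A n (insert e E) e')"

definition is_cand :: "(nat \<Rightarrow> ('s, 'a) lts) \<Rightarrow> nat \<Rightarrow> nat \<Rightarrow> ('s, 'a) event set \<Rightarrow> ('s, 'a) event set \<Rightarrow> ('s, 'a) event \<Rightarrow> bool" where
  "is_cand A n i E co e \<longleftrightarrow> \<not> ievent i e \<and>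
     (\<exists>e'\<in>E. scause n (insert e E) e' e
        \<and> St A n (insert e E) e = St A n (insert e E) e'
        \<and> mcond n (insert e E) e' i = mcond n (insert e E) e i
        \<and> Con i E co e \<subseteq> Con i E co e')"

definition frees :: "(nat \<Rightarrow> ('s, 'a) lts) \<Rightarrow> nat \<Rightarrow> nat \<Rightarrow> ('s, 'a) event set \<Rightarrow> ('s, 'a) event set
                     \<Rightarrow> ('s, 'a) event \<Rightarrow> ('s, 'a) event \<Rightarrow> bool" where
  "frees A n i E co e ec \<longleftrightarrow> is_cand A n i E co ec \<and> \<not> is_cand A n i (insert e E) co ec"

type_synonym ('s, 'a) alg_state = "('s, 'a) event set \<times> ('s, 'a) event set \<times> ('s, 'a) event set"

definition eligible :: "(nat \<Rightarrow> ('s, 'a) lts) \<Rightarrow> nat \<Rightarrow> ('s, 'a) alg_state \<Rightarrow> ('s, 'a) event \<Rightarrow> bool" where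
  "eligible A n st e = (case st of (E, co, coc) \<Rightarrow>
     poss_ext A n E e \<and> (\<forall>e'. less (insert e E) (Inr e') (Inr e) \<longrightarrow> e' \<notin> co \<union> coc))"

definition alg_step :: "(nat \<Rightarrow> ('s, 'a) lts) \<Rightarrow> nat \<Rightarrow> nat \<Rightarrow> ('s, 'a) alg_state \<Rightarrow> ('s, 'a) alg_state \<Rightarrow> bool" where
  "alg_step A n i st st' = (case st of (E, co, coc) \<Rightarrow>
     (\<exists>e. eligible A n st e \<and>
        (if is_cutoff A n i E e then st' = (insert e E, insert e co, coc)
         else if is_cand A n i E co e then st' = (insert e E, co, insert e coc)
         else st' = (insert e E, co, coc - {ec \<in> coc. frees A n i E co e ec}))))"

definition alg_start :: "('s, 'a) alg_state" where
  "alg_start = ({}, {}, {})"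

definition alg_final :: "(nat \<Rightarrow> ('s, 'a) lts) \<Rightarrow> nat \<Rightarrow> ('s, 'a) alg_state \<Rightarrow> bool" where
  "alg_final A n st \<longleftrightarrow> \<not> (\<exists>e. eligible A n st e)"

definition iconds :: "nat \<Rightarrow> nat \<Rightarrow> ('s, 'a) event set \<Rightarrow> ('s, 'a) cond set" where
  "iconds n i E = {c \<in> conds n E. comp c = i}"

definition iproj_rel :: "nat \<Rightarrow> ('s, 'a) event set \<Rightarrow> (('s, 'a) cond \<times> 'a \<times> ('s, 'a) cond) set" where
  "iproj_rel i E = {(b, ev_act e, Out e i) | b e. e \<in> E \<and> ievent i e \<and> b \<in> pre e \<and> comp b = i}"

definition fold_eq :: "(nat \<Rightarrow> ('s, 'a) lts) \<Rightarrow> nat \<Rightarrow> nat \<Rightarrow> ('s, 'a) event set \<Rightarrow> ('s, 'a) event set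
                        \<Rightarrow> (('s, 'a) cond \<times> ('s, 'a) cond) set" where
  "fold_eq A n i E co =
     \<Inter> {Q. equiv (iconds n i E) Q \<and>
            (\<forall>e\<in>co. \<forall>e'\<in>E. ievent i e' \<and> St A n E e = St A n E e'
                 \<longrightarrow> (mcond n E e i, mcond n E e' i) \<in> Q)}"

definition fold_rel :: "(nat \<Rightarrow> ('s, 'a) lts) \<Rightarrow> nat \<Rightarrow> nat \<Rightarrow> ('s, 'a) event set \<Rightarrow> ('s, 'a) event set
                        \<Rightarrow> (('s, 'a) cond set \<times> 'a \<times> ('s, 'a) cond set) set" where
  "fold_rel A n i E co = {(fold_eq A n i E co `` {b}, a, fold_eq A n i E co `` {b'}) | b a b'.
       (b, a, b') \<in> iproj_rel i E}"

definition fold_init :: "(nat \<Rightarrow> ('s, 'a) lts) \<Rightarrow> nat \<Rightarrow> nat \<Rightarrow> ('s, 'a) event set \<Rightarrow> ('s, 'a) event set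
                         \<Rightarrow> ('s, 'a) cond set" where
  "fold_init A n i E co = fold_eq A n i E co `` {Init i}"

definition Tr_fold :: "(nat \<Rightarrow> ('s, 'a) lts) \<Rightarrow> nat \<Rightarrow> nat \<Rightarrow> ('s, 'a) event set \<Rightarrow> ('s, 'a) event set
                       \<Rightarrow> 'a fiseq set" where
  "Tr_fold A n i E co = traces (fold_rel A n i E co) (fold_init A n i E co)"

end

theory Submission
  imports Defs
begin

text \<open>
  Soundness: two i-conditions are identified only if the local configurations producing them lead
  to the same global state, so every step of the folding is matched by firing the events between
  two consecutive i-events.

  Completeness: take a configuration C of the full unfolding extending the local configuration K
  of a non-cut-off i-event x, and induct on the number of events of C outside K. If the next
  i-event f of C lies in the computed process, move on to f or to its companion. Otherwise some
  candidate c lies below f. If x is below c then x is also below the strong cause c' of c, because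
  both have the same i-condition. If x is concurrent with c, then the condition on
  concurrent i-events makes x concurrent with c' too, and strong causality implies that the
  history of x does not touch the part between c' and c. In both cases [c] can be replaced by [c'],
  which yields a smaller configuration with the same remaining behaviour.

  Termination: an infinite run contains an infinite causal chain by Koenig's lemma. Only finitely
  many i-events are not cut-offs, and all of them are present from some moment on. Far out in the
  chain any two events that are far enough apart are strongly causally related, so
  the pigeonhole principle on global state, i-condition and set of concurrent i-events yields a
  candidate that is never freed although it has a successor in the chain.
\<close>

section \<open>Projections of traces\<close>

text \<open>Two features of the algorithm shape the proof. Whether an event is a candidate depends
  on the current process, while completeness looks only at the final one, so the invariant has to
  say that members of \<open>coc\<close> are candidates at every moment. This can be maintained
  because a candidate test that succeeded can fail later only through new i-events that are not
  cut-offs; these are never candidates themselves, so adding one always leads to the freeing branch.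
  Moreover, passing to a companion or to a strong cause preserves a global state but not the events
  that follow it. The future of a configuration is therefore read off as a word of the product and
  replayed elsewhere by other events. A replay keeps the number of events, on which the induction
  runs, and the visible actions, which \<open>hist\<close> recovers from the current i-condition
  alone.\<close>

fun path :: "('q \<times> 'a \<times> 'q) set \<Rightarrow> 'q \<Rightarrow> 'a list \<Rightarrow> 'q \<Rightarrow> bool" where
  "path R p [] q \<longleftrightarrow> p = q"
| "path R p (a # w) q \<longleftrightarrow> (\<exists>r. (p, a, r) \<in> R \<and> path R r w q)"

lemma path_append: "path R p (u @ v) q \<longleftrightarrow> (\<exists>r. path R p u r \<and> path R r v q)"
  by (induction u arbitrary: p) auto

lemma path_iff_nth:
  "path R p w q \<longleftrightarrow> (\<exists>qs. length qs = Suc (length w) \<and> qs ! 0 = p \<and> qs ! length w = q \<and>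
                       (\<forall>k < length w. (qs ! k, w ! k, qs ! Suc k) \<in> R))"
proof (induction w arbitrary: p)
  case Nil
  show ?case by (auto intro: exI[of _ "[p]"])
next
  case (Cons a w)
  show ?case
  proof
    assume "path R p (a # w) q"
    then obtain r where r: "(p, a, r) \<in> R" "path R r w q" by auto
    then obtain qs where "length qs = Suc (length w)" "qs ! 0 = r" "qs ! length w = q"
      "\<forall>k < length w. (qs ! k, w ! k, qs ! Suc k) \<in> R"
      using Cons.IH by blast
    then show "\<exists>qs. length qs = Suc (length (a # w)) \<and> qs ! 0 = p \<and> qs ! length (a # w) = q \<and>
        (\<forall>k < length (a # w). (qs ! k, (a # w) ! k, qs ! Suc k) \<in> R)"
      using r(1) by (intro exI[of _ "p # qs"]) (auto simp: nth_Cons split: nat.splits)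
  next
    assume "\<exists>qs. length qs = Suc (length (a # w)) \<and> qs ! 0 = p \<and> qs ! length (a # w) = q \<and>
        (\<forall>k < length (a # w). (qs ! k, (a # w) ! k, qs ! Suc k) \<in> R)"
    then obtain qs where qs: "length qs = Suc (length (a # w))" "qs ! 0 = p" "qs ! length (a # w) = q"
      "\<And>k. k < length (a # w) \<Longrightarrow> (qs ! k, (a # w) ! k, qs ! Suc k) \<in> R"
      by blast
    have "path R (qs ! 1) w q"
      unfolding Cons.IH
      using qs(1,3) qs(4)[of "Suc _"] by (intro exI[of _ "tl qs"]) (auto simp: nth_tl)
    then show "path R p (a # w) q" using qs(4)[of 0] qs(2) by auto
  qed
qed

lemma FinS_traces_iff: "FinS w \<in> traces R q0 \<longleftrightarrow> (\<exists>q. path R q0 w q)"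
  unfolding traces_def path_iff_nth by auto

lemma InfS_traces_iff:
  "InfS w \<in> traces R q0 \<longleftrightarrow> (\<exists>qs. qs 0 = q0 \<and> (\<forall>k. (qs k, w k, qs (Suc k)) \<in> R))"
  unfolding traces_def by auto

lemma path_of_infinite_run:
  assumes "\<And>k. (qs k, w k, qs (Suc k)) \<in> R"
  shows "path R (qs 0) (map w [0..<m]) (qs m)"
  using assms by (induction m) (auto simp: path_append)

lemma filter_map_enumerate:
  fixes f :: "nat \<Rightarrow> 'a"
  assumes inf: "infinite {k. f k \<in> \<Sigma>}"
  shows "filter (\<lambda>a. a \<in> \<Sigma>) (map f [0..<enumerate {k. f k \<in> \<Sigma>} m]) =
    map (\<lambda>k. f (enumerate {k. f k \<in> \<Sigma>} k)) [0..<m]"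
proof (induction m)
  case 0
  have "f k \<notin> \<Sigma>" if "k < enumerate {k. f k \<in> \<Sigma>} 0" for k
    using that not_less_Least[of k "\<lambda>k. k \<in> {k. f k \<in> \<Sigma>}"] unfolding enumerate_0 by blast
  then show ?case by (simp add: filter_empty_conv)
next
  case (Suc m)
  let ?e = "enumerate {k. f k \<in> \<Sigma>}"
  have lt: "?e m < ?e (Suc m)" using enumerate_step[OF inf] .
  have gap: "f k \<notin> \<Sigma>" if "?e m < k" "k < ?e (Suc m)" for k
    using that enumerate_Suc''[OF inf, of m] not_less_Least[of k "\<lambda>k. k \<in> {k. f k \<in> \<Sigma>} \<and> ?e m < k"]
    by auto
  have vis: "f (?e m) \<in> \<Sigma>" using enumerate_in_set[OF inf, of m] by simp
  have "[0..<?e (Suc m)] = [0..<?e m] @ ?e m # [Suc (?e m)..<?e (Suc m)]"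
    using lt upt_add_eq_append[of 0 "?e m" "?e (Suc m) - ?e m"] by (simp add: upt_conv_Cons)
  moreover have "filter (\<lambda>a. a \<in> \<Sigma>) (map f [Suc (?e m)..<?e (Suc m)]) = []"
    using gap by (auto simp: filter_empty_conv)
  ultimately show ?case using Suc.IH vis by simp
qed

text \<open>Koenig's lemma along a fixed word. A state is \<open>live\<close> if the rest of the
  word can be read from it to any finite length. If no successor of a live state were live, the
  maximum of their finitely many failing lengths would refute the liveness of the state
  itself.\<close>

lemma koenig_run:
  assumes fin: "finite R" and pre: "\<And>m. \<exists>q. path R q0 (map w [0..<m]) q"
  shows "\<exists>qs. qs 0 = q0 \<and> (\<forall>k. (qs k, w k, qs (Suc k)) \<in> R)"
proof -
  define live where "live k q \<longleftrightarrow> (\<forall>m\<ge>k. \<exists>q'. path R q (map w [k..<m]) q')" for k q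
  have step: "\<exists>r. live (Suc k) r \<and> (q, w k, r) \<in> R" if q: "live k q" for k q
  proof (rule ccontr)
    assume "\<not> ?thesis"
    then have "\<forall>r. (q, w k, r) \<in> R \<longrightarrow> (\<exists>m\<ge>Suc k. \<forall>q'. \<not> path R r (map w [Suc k..<m]) q')"
      unfolding live_def by blast
    then obtain d where d: "\<And>r. (q, w k, r) \<in> R \<Longrightarrow> d r \<ge> Suc k \<and> (\<forall>q'. \<not> path R r (map w [Suc k..<d r]) q')"
      by metis
    \<comment> \<open>Inserting \<open>Suc k\<close> makes \<open>[k..<m]\<close> nonempty, so that
      a first step can be split off.\<close>
    define m where "m = Max (insert (Suc k) (d ` snd ` snd ` R))"
    have m: "Suc k \<le> m" "\<And>r. (q, w k, r) \<in> R \<Longrightarrow> d r \<le> m"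
      unfolding m_def using fin by (auto intro!: Max_ge) force
    obtain q' where "path R q (map w [k..<m]) q'" using q m(1) unfolding live_def by (meson Suc_leD)
    then obtain r where r: "(q, w k, r) \<in> R" "path R r (map w [Suc k..<m]) q'"
      using m(1) by (auto simp: upt_conv_Cons)
    have "[Suc k..<m] = [Suc k..<d r] @ [d r..<m]"
      using d[OF r(1)] m(2)[OF r(1)] upt_add_eq_append[of "Suc k" "d r" "m - d r"] by auto
    then show False using r(2) d[OF r(1)] by (auto simp: path_append)
  qed
  have "live 0 q0" using pre unfolding live_def by blast
  then have "\<exists>qs. \<forall>k. (live k (qs k) \<and> (k = 0 \<longrightarrow> qs k = q0)) \<and> (qs k, w k, qs (Suc k)) \<in> R"
    by (intro dependent_nat_choice) (use step in auto)
  then show ?thesis by blast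
qed

text \<open>Finite words suffice when \<open>R\<close> is finite. An infinite run with finitely many
  visible actions projects to the projection of a finite prefix; otherwise every prefix of the
  projected word can be read and \<open>koenig_run\<close> yields an infinite run.\<close>

lemma proj_traces_subset:
  assumes "finite R"
    and complete: "\<And>u q. path R' p0 u q \<Longrightarrow> \<exists>q'. path R q0 (filter (\<lambda>a. a \<in> \<Sigma>) u) q'"
  shows "proj \<Sigma> ` traces R' p0 \<subseteq> traces R q0"
proof
  fix t assume "t \<in> proj \<Sigma> ` traces R' p0"
  then obtain t' where t': "t' \<in> traces R' p0" "t = proj \<Sigma> t'" by blast
  show "t \<in> traces R q0"
  proof (cases t')
    case (FinS u)
    then show ?thesis using t' complete by (auto simp: FinS_traces_iff)
  next
    case (InfS f)
    then obtain qs where qs: "qs 0 = p0" "\<And>k. (qs k, f k, qs (Suc k)) \<in> R'"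
      using t'(1) by (auto simp: InfS_traces_iff)
    have fin: "\<exists>q'. path R q0 (filter (\<lambda>a. a \<in> \<Sigma>) (map f [0..<m])) q'" for m
      using complete path_of_infinite_run[of qs f R' m] qs by metis
    show ?thesis
    proof (cases "finite {k. f k \<in> \<Sigma>}")
      case True
      then show ?thesis using fin t'(2) InfS by (auto simp: FinS_traces_iff)
    next
      case False
      have "\<exists>q'. path R q0 (map (\<lambda>k. f (enumerate {k. f k \<in> \<Sigma>} k)) [0..<m]) q'" for m
        using fin unfolding filter_map_enumerate[OF False, symmetric] by blast
      from koenig_run[OF assms(1) this] show ?thesis
        using False t'(2) InfS by (auto simp: InfS_traces_iff)
    qed
  qed
qed

lemma weak_sim_path:
  assumes sim: "\<And>q a q'. (q, a, q') \<in> R \<Longrightarrow> \<exists>u. path R' (h q) u (h q') \<and> filter P u = [a]"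
  shows "path R q w q' \<Longrightarrow> \<exists>u. path R' (h q) u (h q') \<and> filter P u = w"
proof (induction w arbitrary: q)
  case Nil
  then show ?case by (intro exI[of _ "[]"]) auto
next
  case (Cons a w)
  then obtain r where "(q, a, r) \<in> R" "path R r w q'" by auto
  with sim Cons.IH obtain u v where "path R' (h q) u (h r)" "filter P u = [a]"
    "path R' (h r) v (h q')" "filter P v = w" by blast
  then show ?case by (intro exI[of _ "u @ v"]) (auto simp: path_append)
qed

text \<open>The simulating words are joined into one infinite run by emitting a single action per
  step. Each of them contains a visible action and is thus nonempty, so the run never
  stalls.\<close>

lemma weak_sim_run:
  assumes sim: "\<And>q a q'. (q, a, q') \<in> R \<Longrightarrow> \<exists>u. path R' (h q) u (h q') \<and> filter (\<lambda>a. a \<in> \<Sigma>) u = [a]"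
    and run: "InfS w \<in> traces R q0"
  shows "\<exists>v. InfS v \<in> traces R' (h q0) \<and> proj \<Sigma> (InfS v) = InfS w"
proof -
  obtain qs where qs: "qs 0 = q0" "\<And>k. (qs k, w k, qs (Suc k)) \<in> R"
    using run by (auto simp: InfS_traces_iff)
  \<comment> \<open>a point of the simulating run: current state, pending word, number of visible actions so far\<close>
  define P where "P = (\<lambda>(g, u, k). path R' g u (h (qs (Suc k))) \<and> filter (\<lambda>a. a \<in> \<Sigma>) u = [w k])"
  define Q where "Q = (\<lambda>(g, u, k) (g', u', k'). (g, hd u, g') \<in> R' \<and>
    (if hd u \<in> \<Sigma> then hd u = w k \<and> k' = Suc k else k' = (k::nat) \<and> u' = tl u))"
  have base: "\<exists>x. P x \<and> (0 = (0::nat) \<longrightarrow> fst x = h q0 \<and> snd (snd x) = 0)"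
    using sim[OF qs(2)[of 0]] qs(1) unfolding P_def by auto
  have step: "\<exists>y. (P y \<and> (Suc t = 0 \<longrightarrow> fst y = h q0 \<and> snd (snd y) = 0)) \<and> Q x y"
    if "P x \<and> (t = 0 \<longrightarrow> fst x = h q0 \<and> snd (snd x) = 0)" for x t
  proof -
    obtain g u k where x: "x = (g, u, k)" by (cases x) auto
    have u: "path R' g u (h (qs (Suc k)))" "filter (\<lambda>a. a \<in> \<Sigma>) u = [w k]"
      using that unfolding P_def x by auto
    then obtain a u1 where a: "u = a # u1" by (cases u) auto
    with u obtain r where r: "(g, a, r) \<in> R'" "path R' r u1 (h (qs (Suc k)))" by auto
    show ?thesis
    proof (cases "a \<in> \<Sigma>")
      case True
      \<comment> \<open>The invisible rest \<open>u1\<close> is put in front of the next segment, so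
        the pending word again contains exactly one visible action.\<close>
      obtain u2 where "path R' (h (qs (Suc k))) u2 (h (qs (Suc (Suc k))))"
        "filter (\<lambda>a. a \<in> \<Sigma>) u2 = [w (Suc k)]"
        using sim[OF qs(2)[of "Suc k"]] by blast
      then show ?thesis
        using r u(2) a True unfolding P_def Q_def x
        by (intro exI[of _ "(r, u1 @ u2, Suc k)"]) (auto simp: path_append)
    next
      case False
      then show ?thesis
        using r u(2) a unfolding P_def Q_def x by (intro exI[of _ "(r, u1, k)"]) auto
    qed
  qed
  have "\<exists>z. \<forall>t. (P (z t) \<and> (t = 0 \<longrightarrow> fst (z t) = h q0 \<and> snd (snd (z t)) = 0)) \<and> Q (z t) (z (Suc t))"
    by (rule dependent_nat_choice[of "\<lambda>t x. P x \<and> (t = 0 \<longrightarrow> fst x = h q0 \<and> snd (snd x) = 0)" "\<lambda>_. Q"])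
      (fact base, fact step)
  then obtain z where z: "\<And>t. P (z t)" "fst (z 0) = h q0" "snd (snd (z 0)) = 0" "\<And>t. Q (z t) (z (Suc t))"
    by blast
  define g u \<kappa> where "g t = fst (z t)" and "u t = fst (snd (z t))" and "\<kappa> t = snd (snd (z t))" for t
  have zt: "z t = (g t, u t, \<kappa> t)" for t unfolding g_def u_def \<kappa>_def by simp
  define v where "v t = hd (u t)" for t
  have ne: "u t \<noteq> []" for t using z(1)[of t] unfolding P_def zt by auto
  have Qs: "(g t, v t, g (Suc t)) \<in> R'" "v t \<in> \<Sigma> \<Longrightarrow> v t = w (\<kappa> t) \<and> \<kappa> (Suc t) = Suc (\<kappa> t)"
    "v t \<notin> \<Sigma> \<Longrightarrow> \<kappa> (Suc t) = \<kappa> t \<and> u (Suc t) = tl (u t)" for t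
    using z(4)[of t] unfolding Q_def zt v_def by auto
  have word: "filter (\<lambda>a. a \<in> \<Sigma>) (map v [0..<t]) = map w [0..<\<kappa> t]" for t
  proof (induction t)
    case 0
    show ?case using z(3) unfolding \<kappa>_def by simp
  next
    case (Suc t)
    then show ?case using Qs(2,3)[of t] by (cases "v t \<in> \<Sigma>") auto
  qed
  have inf: "infinite {t. v t \<in> \<Sigma>}"
  proof
    assume "finite {t. v t \<in> \<Sigma>}"
    then obtain N where N: "\<And>t. t \<ge> N \<Longrightarrow> v t \<notin> \<Sigma>"
      using finite_nat_set_iff_bounded by (metis mem_Collect_eq not_le)
    \<comment> \<open>Without visible actions the pending word only shrinks and would be empty after
      \<open>length (u N)\<close> steps.\<close>
    have "u (N + m) = drop m (u N)" for m
      by (induction m) (use Qs(3) N in \<open>auto simp: tl_drop drop_Suc\<close>)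
    from this[of "length (u N)"] show False using ne by simp
  qed
  have "w m = v (enumerate {t. v t \<in> \<Sigma>} m)" for m
  proof -
    \<comment> \<open>The prefix before visible position number \<open>Suc m\<close> contains the
      visible actions numbered 0 to \<open>m\<close>, so entry \<open>m\<close> is its last
      one.\<close>
    have "map w [0..<\<kappa> (enumerate {t. v t \<in> \<Sigma>} (Suc m))] =
      map (\<lambda>k. v (enumerate {t. v t \<in> \<Sigma>} k)) [0..<Suc m]"
      using filter_map_enumerate[OF inf, of "Suc m"] word by metis
    then have "length (map w [0..<\<kappa> (enumerate {t. v t \<in> \<Sigma>} (Suc m))]) = Suc m"
      and eq: "map w [0..<\<kappa> (enumerate {t. v t \<in> \<Sigma>} (Suc m))] ! m =
        map (\<lambda>k. v (enumerate {t. v t \<in> \<Sigma>} k)) [0..<Suc m] ! m" by simp_all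
    then show ?thesis by (simp del: upt_Suc)
  qed
  then have "proj \<Sigma> (InfS v) = InfS w" using inf by auto
  moreover have "InfS v \<in> traces R' (h q0)"
    using Qs(1) z(2) unfolding InfS_traces_iff by (intro exI[of _ g]) (auto simp: g_def)
  ultimately show ?thesis by blast
qed

lemma weak_sim_traces:
  assumes "\<And>q a q'. (q, a, q') \<in> R \<Longrightarrow> \<exists>u. path R' (h q) u (h q') \<and> filter (\<lambda>a. a \<in> \<Sigma>) u = [a]"
  shows "traces R q0 \<subseteq> proj \<Sigma> ` traces R' (h q0)"
proof
  fix t assume t: "t \<in> traces R q0"
  show "t \<in> proj \<Sigma> ` traces R' (h q0)"
  proof (cases t)
    case (FinS w)
    then obtain q where "path R q0 w q" using t by (auto simp: FinS_traces_iff)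
    then obtain u where "path R' (h q0) u (h q)" "filter (\<lambda>a. a \<in> \<Sigma>) u = w"
      using weak_sim_path[of R R' h "\<lambda>a. a \<in> \<Sigma>"] assms by metis
    then show ?thesis
      using FinS by (intro image_eqI[of _ _ "FinS u"]) (auto simp: FinS_traces_iff)
  next
    case (InfS w)
    then show ?thesis using weak_sim_run[of R R' h \<Sigma> w q0] assms t by (metis image_eqI)
  qed
qed

section \<open>Causality and configurations\<close>

text \<open>Events carry their whole history, so causality can be read off an event without
  reference to an ambient branching process.\<close>

definition dpred :: "(('s, 'a) event \<times> ('s, 'a) event) set" where
  "dpred = {(x, e). \<exists>j. Out x j \<in> pre e}"

definition past :: "('s, 'a) event \<Rightarrow> ('s, 'a) event set" where
  "past e = {x. (x, e) \<in> dpred\<^sup>*}"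

definition wfe :: "(nat \<Rightarrow> ('s, 'a) lts) \<Rightarrow> nat \<Rightarrow> ('s, 'a) event \<Rightarrow> bool" where
  "wfe A n e \<longleftrightarrow> gtrans A n (ev_act e) (ev_tt e) \<and> labelled_by_pre A (ev_tt e) (pre e)"

text \<open>Configurations of the full unfolding, independent of any computed process. Causal
  closure is hidden in \<open>pre e \<subseteq> conds n C\<close>: the condition
  \<open>Out x j\<close> belongs to \<open>conds n C\<close> only if \<open>x\<close> belongs to
  \<open>C\<close>.\<close>

definition config :: "(nat \<Rightarrow> ('s, 'a) lts) \<Rightarrow> nat \<Rightarrow> ('s, 'a) event set \<Rightarrow> bool" where
  "config A n C \<longleftrightarrow> finite C \<and> (\<forall>e\<in>C. wfe A n e \<and> pre e \<subseteq> conds n C)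
     \<and> (\<forall>e\<in>C. \<forall>f\<in>C. pre e \<inter> pre f \<noteq> {} \<longrightarrow> e = f)"

definition cutset :: "nat \<Rightarrow> ('s, 'a) event set \<Rightarrow> ('s, 'a) cond set" where
  "cutset n C = conds n C - \<Union> (pre ` C)"

definition cutc :: "nat \<Rightarrow> ('s, 'a) event set \<Rightarrow> nat \<Rightarrow> ('s, 'a) cond" where
  "cutc n C j = (THE c. c \<in> cutset n C \<and> comp c = j)"

text \<open>Components from \<open>n\<close> on get their value in \<open>prod_init\<close>, which
  no transition changes, so global states can be compared as functions.\<close>

definition gst :: "(nat \<Rightarrow> ('s, 'a) lts) \<Rightarrow> nat \<Rightarrow> ('s, 'a) event set \<Rightarrow> nat \<Rightarrow> 's" where
  "gst A n C = (\<lambda>j. if j < n then clab A (cutc n C j) else init (A j))"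

text \<open>Direct causes of an event are subterms of it, so the mutual induction principle of
  \<open>cond\<close> and \<open>event\<close> gives well-foundedness.\<close>

lemma wf_dpred: "wf (dpred :: (('s, 'a) event \<times> ('s, 'a) event) set)"
proof (rule wfUNIVI)
  fix P :: "('s, 'a) event \<Rightarrow> bool" and e
  assume step: "\<forall>x. (\<forall>y. (y, x) \<in> dpred \<longrightarrow> P y) \<longrightarrow> P x"
  have "case c of Init j \<Rightarrow> True | Out x j \<Rightarrow> P x" and "P e" for c :: "('s, 'a) cond"
  proof (induction c and e rule: cond.induct event.induct)
    case (Ev a tt M)
    have "P y" if "(y, Ev a tt M) \<in> dpred" for y
      using that Ev unfolding dpred_def by fastforce
    then show ?case using step by blast
  qed auto
  then show "P e" by blast
qed

lemma dpred_acyclic: "(e, e) \<notin> dpred\<^sup>+"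
  using wf_acyclic[OF wf_dpred] unfolding acyclic_def by blast

lemma past_self [simp]: "e \<in> past e"
  unfolding past_def by simp

lemma past_trans: "x \<in> past y \<Longrightarrow> y \<in> past z \<Longrightarrow> x \<in> past z"
  unfolding past_def by auto

lemma past_antisym: "x \<in> past y \<Longrightarrow> y \<in> past x \<Longrightarrow> x = y"
  unfolding past_def
  by (metis dpred_acyclic mem_Collect_eq rtranclD trancl_rtrancl_trancl)

lemma pre_Out_past: "Out x j \<in> pre e \<Longrightarrow> x \<in> past e"
  unfolding past_def dpred_def by auto

lemma pre_Out_neq: "Out x j \<in> pre e \<Longrightarrow> x \<noteq> e"
  using dpred_acyclic[of e] unfolding dpred_def by auto

lemma Init_in_conds [simp]: "Init j \<in> conds n C \<longleftrightarrow> j < n"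
  unfolding conds_def init_mark_def post_def by auto

lemma Out_in_conds [simp]: "Out x j \<in> conds n C \<longleftrightarrow> x \<in> C \<and> ev_tt x j \<noteq> None"
  unfolding conds_def init_mark_def post_def by auto

lemma conds_mono: "C \<subseteq> D \<Longrightarrow> conds n C \<subseteq> conds n D"
  unfolding conds_def by auto

lemma conds_insert: "conds n (insert e C) = conds n C \<union> post e"
  unfolding conds_def by auto

lemma wfe_pre:
  assumes "wfe A n e" "b \<in> pre e"
  shows "comp b < n" "ev_tt e (comp b) \<noteq> None" "clab A b = fst (the (ev_tt e (comp b)))"
proof -
  show tt: "ev_tt e (comp b) \<noteq> None" and "clab A b = fst (the (ev_tt e (comp b)))"
    using assms unfolding wfe_def labelled_by_pre_def by blast+
  then show "comp b < n" using assms unfolding wfe_def gtrans_def by (meson leI)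
qed

lemma wfe_tt_less: "wfe A n e \<Longrightarrow> ev_tt e j \<noteq> None \<Longrightarrow> j < n"
  unfolding wfe_def gtrans_def by (meson leI)

lemma wfe_ex_pre:
  assumes "wfe A n e" "ev_tt e j \<noteq> None"
  obtains b where "b \<in> pre e" "comp b = j"
proof -
  have "j \<in> comp ` pre e" using assms unfolding wfe_def labelled_by_pre_def by auto
  then show ?thesis using that by auto
qed

lemma wfe_inj: "wfe A n e \<Longrightarrow> inj_on comp (pre e)"
  unfolding wfe_def labelled_by_pre_def by auto

lemma wfe_pre_nonempty: "wfe A n e \<Longrightarrow> pre e \<noteq> {}"
  unfolding wfe_def labelled_by_pre_def gtrans_def by auto

lemma wfe_ievent_iff: "wfe A n e \<Longrightarrow> i < n \<Longrightarrow> ev_act e \<in> acts (A i) \<longleftrightarrow> ev_tt e i \<noteq> None"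
  unfolding wfe_def gtrans_def by (metis option.distinct(1))

lemma config_finite: "config A n C \<Longrightarrow> finite C"
  and config_wfe: "config A n C \<Longrightarrow> e \<in> C \<Longrightarrow> wfe A n e"
  and config_pre: "config A n C \<Longrightarrow> e \<in> C \<Longrightarrow> b \<in> pre e \<Longrightarrow> b \<in> conds n C"
  and config_conflict_free:
    "config A n C \<Longrightarrow> e \<in> C \<Longrightarrow> f \<in> C \<Longrightarrow> b \<in> pre e \<Longrightarrow> b \<in> pre f \<Longrightarrow> e = f"
  unfolding config_def by blast+

lemma config_past_subset:
  assumes "config A n C" "e \<in> C"
  shows "past e \<subseteq> C"
proof
  fix x assume "x \<in> past e"
  then have "(x, e) \<in> dpred\<^sup>*" unfolding past_def by simp
  then show "x \<in> C"
    using assms(2)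
  proof (induction rule: converse_rtrancl_induct)
    case (step y z)
    then obtain j where "Out y j \<in> pre z" unfolding dpred_def by auto
    with config_pre[OF assms(1) step.IH[OF step.prems]] have "Out y j \<in> conds n C" by blast
    then show ?case by simp
  qed
qed

lemma config_subset:
  assumes C: "config A n C" and D: "D \<subseteq> C" "\<And>e. e \<in> D \<Longrightarrow> past e \<subseteq> D"
  shows "config A n D"
  unfolding config_def
proof (intro conjI ballI impI)
  show "finite D" using C D(1) config_finite finite_subset by blast
next
  fix e assume e: "e \<in> D"
  then show "wfe A n e" using C D(1) config_wfe by blast
  show "pre e \<subseteq> conds n D"
  proof
    fix b assume b: "b \<in> pre e"
    then have "b \<in> conds n C" using C D(1) e config_pre by blast
    then show "b \<in> conds n D"
      using b D(2)[OF e] pre_Out_past by (cases b) auto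
  qed
next
  fix e f assume "e \<in> D" "f \<in> D" "pre e \<inter> pre f \<noteq> {}"
  then show "e = f" using C D(1) config_conflict_free by blast
qed

lemma config_past: "config A n C \<Longrightarrow> e \<in> C \<Longrightarrow> config A n (past e)"
  by (rule config_subset[of _ _ C]) (auto dest: config_past_subset past_trans)

lemma config_empty [simp]: "config A n {}"
  unfolding config_def by auto

lemma config_insert:
  assumes C: "config A n C" and e: "wfe A n e" "pre e \<subseteq> cutset n C"
  shows "e \<notin> C" "config A n (insert e C)"
    "cutset n (insert e C) = (cutset n C - pre e) \<union> post e"
proof -
  show e_new: "e \<notin> C"
    using wfe_pre_nonempty[OF e(1)] e(2) unfolding cutset_def by auto
  show "config A n (insert e C)"
    using C e unfolding config_def cutset_def conds_insert by blast
  have "Out e j \<notin> pre f" if "f \<in> insert e C" for f j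
    using that config_pre[OF C, of f "Out e j"] e_new pre_Out_neq[of e j e] by auto
  then have "post e \<inter> \<Union> (pre ` insert e C) = {}" unfolding post_def by blast
  then show "cutset n (insert e C) = (cutset n C - pre e) \<union> post e"
    unfolding cutset_def conds_insert by auto
qed

lemma config_induct_from [consumes 3, case_names base step]:
  assumes "config A n C" "config A n K" "K \<subseteq> C"
    and base: "P K"
    and step: "\<And>D e. K \<subseteq> D \<Longrightarrow> config A n D \<Longrightarrow> wfe A n e \<Longrightarrow> pre e \<subseteq> cutset n D \<Longrightarrow>
      insert e D \<subseteq> C \<Longrightarrow> e \<notin> D \<Longrightarrow> P D \<Longrightarrow> P (insert e D)"
  shows "P C"
proof -
  have "P C" if "K \<subseteq> D" "D \<subseteq> C" "config A n D" "P D" for D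
    using that
  proof (induction "card (C - D)" arbitrary: D)
    case 0
    then have "C - D = {}" using config_finite[OF assms(1)] by auto
    then show ?case using 0 by auto
  next
    case (Suc k)
    then have "C - D \<noteq> {}" by (metis card.empty nat.distinct(1))
    then obtain e where e: "e \<in> C - D" and min: "\<And>y. (y, e) \<in> dpred \<Longrightarrow> y \<notin> C - D"
      using wfE_min[OF wf_dpred] by (metis all_not_in_conv)
    have "b \<in> cutset n D" if b: "b \<in> pre e" for b
    proof -
      have "b \<in> conds n C" using config_pre[OF assms(1)] e b by blast
      then have "b \<in> conds n D" using min b e unfolding dpred_def by (cases b) auto
      moreover have "b \<notin> pre f" if "f \<in> D" for f
        using config_conflict_free[OF assms(1)] that Suc.prems(2) e b by blast
      ultimately show ?thesis unfolding cutset_def by blast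
    qed
    then have pre: "pre e \<subseteq> cutset n D" by blast
    have wfe: "wfe A n e" using config_wfe assms(1) e by blast
    have "C - insert e D = (C - D) - {e}" by blast
    then have "card (C - insert e D) = k"
      using Suc.hyps(2) e config_finite[OF assms(1)] by (simp add: card_Diff_singleton)
    moreover have "P (insert e D)"
      using step[OF Suc.prems(1,3) wfe pre] e Suc.prems by blast
    ultimately show ?case
      using Suc.hyps(1)[of "insert e D"] Suc.prems config_insert[OF Suc.prems(3) wfe pre] e by blast
  qed
  then show ?thesis using assms(2,3) base by blast
qed

lemma config_induct [consumes 1, case_names empty step]:
  assumes "config A n C" "P {}"
    and "\<And>D e. config A n D \<Longrightarrow> wfe A n e \<Longrightarrow> pre e \<subseteq> cutset n D \<Longrightarrow>
      insert e D \<subseteq> C \<Longrightarrow> e \<notin> D \<Longrightarrow> P D \<Longrightarrow> P (insert e D)"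
  shows "P C"
  using config_induct_from[OF assms(1) config_empty, of P] assms(2,3) by blast

section \<open>Cuts and global states of configurations\<close>

lemma cutset_empty: "cutset n {} = init_mark n"
  unfolding cutset_def conds_def by auto

lemma cutset_comp_less: 
  assumes "config A n C" "c \<in> cutset n C" 
  shows "comp c < n"
  using assms wfe_tt_less[of A n] config_wfe[OF assms(1)]
  unfolding cutset_def by (cases c) auto

text \<open>An event consumes one condition and produces one for each participating component, so
  every component always holds exactly one token.\<close>

lemma cutset_ex1:
  assumes "config A n C" "j < n"
  shows "\<exists>!c. c \<in> cutset n C \<and> comp c = j"
  using assms(1)
proof (induction rule: config_induct)
  case empty
  show ?case using assms(2) by (auto simp: cutset_empty init_mark_def)
next
  case (step D e)
  note cut = config_insert(3)[OF step(1-3)]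
  show ?case
  proof (cases "ev_tt e j = None")
    case True
    then have "c \<in> cutset n (insert e D) \<longleftrightarrow> c \<in> cutset n D" if "comp c = j" for c
      using that wfe_pre(2)[OF step(2), of c] unfolding cut by (auto simp: post_def)
    then show ?thesis using step.IH by metis
  next
    case False
    then obtain b where b: "b \<in> pre e" "comp b = j" using wfe_ex_pre[OF step(2)] by blast
    have "c \<in> cutset n (insert e D) \<and> comp c = j \<longleftrightarrow> c = Out e j" for c
      using step.IH b step(3) False unfolding cut by (auto simp: post_def)
    then show ?thesis by simp
  qed
qed

lemma cutc_in:
  assumes "config A n C" "j < n"
  shows "cutc n C j \<in> cutset n C" "comp (cutc n C j) = j"
  using theI'[OF cutset_ex1[OF assms]] unfolding cutc_def by auto

lemma cutc_eqI: "config A n C \<Longrightarrow> c \<in> cutset n C \<Longrightarrow> comp c = j \<Longrightarrow> cutc n C j = c"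
  using cutset_ex1[of A n C j] cutset_comp_less[of A n C c] cutc_in[of A n C j] by metis

lemma cutc_insert:
  assumes "config A n C" "wfe A n e" "pre e \<subseteq> cutset n C" "j < n"
  shows "cutc n (insert e C) j = (if ev_tt e j = None then cutc n C j else Out e j)"
proof (rule cutc_eqI[OF config_insert(2)[OF assms(1-3)]])
  show "(if ev_tt e j = None then cutc n C j else Out e j) \<in> cutset n (insert e C)"
    unfolding config_insert(3)[OF assms(1-3)]
    using cutc_in[OF assms(1,4)] wfe_pre(2)[OF assms(2), of "cutc n C j"]
    by (auto simp: post_def)
  show "comp (if ev_tt e j = None then cutc n C j else Out e j) = j"
    using cutc_in[OF assms(1,4)] by auto
qed

lemma cutc_empty: "j < n \<Longrightarrow> cutc n {} j = Init j"
  by (rule cutc_eqI[OF config_empty]) (auto simp: cutset_empty init_mark_def)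

lemma gst_empty: "gst A n {} = prod_init A n"
  unfolding gst_def prod_init_def by (auto simp: cutc_empty)

lemma gst_step:
  assumes C: "config A n C" and e: "wfe A n e" "pre e \<subseteq> cutset n C"
  shows "(gst A n C, ev_act e, gst A n (insert e C)) \<in> prod_rel A n"
proof -
  have "gst A n C j = fst t" if t: "ev_tt e j = Some t" for j t
  proof -
    obtain b where b: "b \<in> pre e" "comp b = j" using wfe_ex_pre[OF e(1), of j] t by auto
    then have "cutc n C j = b" using cutc_eqI[OF C] e(2) by blast
    then show ?thesis
      using wfe_pre[OF e(1) b(1)] b(2) t unfolding gst_def by auto
  qed
  moreover have "gst A n (insert e C) = (\<lambda>j. case ev_tt e j of None \<Rightarrow> gst A n C j | Some t \<Rightarrow> snd t)"
  proof
    show "gst A n (insert e C) j = (case ev_tt e j of None \<Rightarrow> gst A n C j | Some t \<Rightarrow> snd t)" for j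
      using wfe_tt_less[OF e(1), of j] cutc_insert[OF C e, of j] unfolding gst_def
      by (cases "ev_tt e j") auto
  qed
  ultimately show ?thesis
    using e(1) unfolding prod_rel_def wfe_def by auto
qed

text \<open>The event is built directly: an event is a global transition with an input set, and the
  current conditions of the participants serve as inputs.\<close>

lemma gst_step_ex:
  assumes C: "config A n C" and step: "(gst A n C, a, g) \<in> prod_rel A n"
  obtains e where "wfe A n e" "pre e \<subseteq> cutset n C" "ev_act e = a" "g = gst A n (insert e C)"
proof -
  obtain tt where tt: "gtrans A n a tt" "\<And>j t. tt j = Some t \<Longrightarrow> gst A n C j = fst t"
    "g = (\<lambda>j. case tt j of None \<Rightarrow> gst A n C j | Some t \<Rightarrow> snd t)"
    using step unfolding prod_rel_def by auto
  define J where "J = {j. tt j \<noteq> None}"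
  have J: "j < n" if "j \<in> J" for j
    using tt(1) that unfolding J_def gtrans_def by (metis mem_Collect_eq not_le)
  then have "finite J" using finite_subset[of J "{..<n}"] by auto
  define M where "M = Abs_fset (cutc n C ` J)"
  have M: "fset M = cutc n C ` J"
    unfolding M_def using \<open>finite J\<close> by (simp add: Abs_fset_inverse)
  define e where "e = Ev a tt M"
  have "labelled_by_pre A tt (fset M)"
    unfolding labelled_by_pre_def M
    using J cutc_in(2)[OF C] tt(2) unfolding J_def gst_def
    by (auto simp: inj_on_def image_iff)
  then have wfe: "wfe A n e" using tt(1) unfolding wfe_def e_def by simp
  have pre: "pre e \<subseteq> cutset n C"
    unfolding e_def using J cutc_in(1)[OF C] by (auto simp: M)
  have "g = gst A n (insert e C)"
  proof
    show "g j = gst A n (insert e C) j" for j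
      using J[of j] cutc_insert[OF C wfe pre, of j] unfolding tt(3) gst_def J_def
      by (cases "tt j") (auto simp: e_def)
  qed
  then show ?thesis using that[OF wfe pre] by (simp add: e_def)
qed

text \<open>The word of actions that a component has performed when it reaches a condition;
  it makes the projection of a run independent of how concurrent events are interleaved.\<close>

inductive hist :: "nat \<Rightarrow> ('s, 'a) cond \<Rightarrow> 'a list \<Rightarrow> bool" for i where
  hist_Init: "hist i (Init i) []"
| hist_Out: "b \<in> pre e \<Longrightarrow> comp b = i \<Longrightarrow> inj_on comp (pre e) \<Longrightarrow> hist i b w
    \<Longrightarrow> hist i (Out e i) (w @ [ev_act e])"

text \<open>The premise \<open>inj_on comp (pre e)\<close> of \<open>hist_Out\<close> leaves only
  one input condition for component \<open>i\<close>.\<close>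

lemma hist_unique: "hist i b v \<Longrightarrow> hist i b w \<Longrightarrow> v = w"
proof (induction arbitrary: w rule: hist.induct)
  case hist_Init
  then show ?case by (auto elim: hist.cases)
next
  case (hist_Out b e v)
  from hist_Out.prems obtain b' w' where
    "b' \<in> pre e" "comp b' = i" "hist i b' w'" "w = w' @ [ev_act e]"
    by (auto elim: hist.cases)
  then show ?case using hist_Out by (metis inj_onD)
qed

lemma hist_insert:
  assumes "config A n C" "wfe A n e" "pre e \<subseteq> cutset n C" "i < n" "hist i (cutc n C i) w"
  shows "hist i (cutc n (insert e C) i) (w @ filter (\<lambda>a. a \<in> acts (A i)) [ev_act e])"
proof (cases "ev_tt e i = None")
  case True
  then show ?thesis
    using assms(5) wfe_ievent_iff[OF assms(2,4)] cutc_insert[OF assms(1-4)] by simp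
next
  case False
  then obtain b where b: "b \<in> pre e" "comp b = i" using wfe_ex_pre[OF assms(2)] by blast
  then have "cutc n C i = b" using cutc_eqI[OF assms(1), of b i] assms(3) by blast
  then have "hist i (Out e i) (w @ [ev_act e])"
    using hist_Out[OF b wfe_inj[OF assms(2)]] assms(5) by blast
  then show ?thesis
    using False wfe_ievent_iff[OF assms(2,4)] cutc_insert[OF assms(1-4)] by auto
qed

lemma config_path:
  assumes "config A n C" "config A n K" "K \<subseteq> C" "i < n" "hist i (cutc n K i) w"
  obtains u where "path (prod_rel A n) (gst A n K) u (gst A n C)" "card C = card K + length u"
    "hist i (cutc n C i) (w @ filter (\<lambda>a. a \<in> acts (A i)) u)"
proof -
  have "\<exists>u. path (prod_rel A n) (gst A n K) u (gst A n C) \<and> card C = card K + length u \<and>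
    hist i (cutc n C i) (w @ filter (\<lambda>a. a \<in> acts (A i)) u)"
    using assms(1-3)
  proof (induction rule: config_induct_from)
    case base
    show ?case using assms(5) by (intro exI[of _ "[]"]) auto
  next
    case (step D e)
    then obtain u where u: "path (prod_rel A n) (gst A n K) u (gst A n D)"
      "card D = card K + length u" "hist i (cutc n D i) (w @ filter (\<lambda>a. a \<in> acts (A i)) u)"
      by blast
    have "path (prod_rel A n) (gst A n K) (u @ [ev_act e]) (gst A n (insert e D))"
      using u(1) gst_step[OF step(2-4)] by (auto simp: path_append)
    moreover have "card (insert e D) = card K + length (u @ [ev_act e])"
      using u(2) step.hyps config_finite[OF step(2)] by simp
    moreover have "hist i (cutc n (insert e D) i) (w @ filter (\<lambda>a. a \<in> acts (A i)) (u @ [ev_act e]))"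
      using hist_insert[OF step(2-4) assms(4) u(3)] by simp
    ultimately show ?case by blast
  qed
  then show ?thesis using that by blast
qed

text \<open>Together with \<open>config_path\<close> this transplants the future of one
  configuration onto any other with the same global state. The events differ, but their number and
  the visible word are the same.\<close>

lemma path_config:
  assumes "config A n K" "path (prod_rel A n) (gst A n K) u g" "i < n" "hist i (cutc n K i) w"
  obtains C where "config A n C" "K \<subseteq> C" "gst A n C = g" "card C = card K + length u"
    "hist i (cutc n C i) (w @ filter (\<lambda>a. a \<in> acts (A i)) u)"
proof -
  have "\<exists>C. config A n C \<and> K \<subseteq> C \<and> gst A n C = g \<and> card C = card K + length u \<and>
    hist i (cutc n C i) (w @ filter (\<lambda>a. a \<in> acts (A i)) u)"
    using assms
  proof (induction u arbitrary: K w)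
    case Nil
    then show ?case by auto
  next
    case (Cons a u)
    then obtain g' where g': "(gst A n K, a, g') \<in> prod_rel A n" "path (prod_rel A n) g' u g"
      by auto
    obtain e where e: "wfe A n e" "pre e \<subseteq> cutset n K" "ev_act e = a" "g' = gst A n (insert e K)"
      using gst_step_ex[OF Cons.prems(1) g'(1)] by blast
    note ins = config_insert[OF Cons.prems(1) e(1,2)]
    obtain C where "config A n C" "insert e K \<subseteq> C" "gst A n C = g"
      "card C = card (insert e K) + length u"
      "hist i (cutc n C i) ((w @ filter (\<lambda>a. a \<in> acts (A i)) [a]) @ filter (\<lambda>a. a \<in> acts (A i)) u)"
      using Cons.IH[OF ins(2) _ Cons.prems(3)] g'(2)
        hist_insert[OF Cons.prems(1) e(1,2) Cons.prems(3,4)] e(3,4) by blast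
    then show ?case
      using ins(1) config_finite[OF Cons.prems(1)] by (intro exI[of _ C]) auto
  qed
  then show ?thesis using that by blast
qed

lemma config_hist_ex:
  assumes "config A n C" "i < n"
  obtains w where "hist i (cutc n C i) w"
proof -
  have "hist i (cutc n {} i) []" using cutc_empty[OF assms(2)] hist_Init by metis
  from config_path[OF assms(1) config_empty empty_subsetI assms(2) this] show ?thesis using that by blast
qed

section \<open>Events of one component\<close>

text \<open>The events of one component in a configuration form a causal chain, each consuming what
  the previous one produced for the component, and the current condition comes from the last of
  them.\<close>

lemma cutc_above:
  assumes "config A n C" "y \<in> C" "ev_tt y j \<noteq> None"
  obtains z where "cutc n C j = Out z j" "z \<in> C" "y \<in> past z" "ev_tt z j \<noteq> None"
proof -
  have jn: "j < n" using assms config_wfe wfe_tt_less by blast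
  have "\<forall>y\<in>C. ev_tt y j \<noteq> None \<longrightarrow> (\<exists>z. cutc n C j = Out z j \<and> z \<in> C \<and> y \<in> past z \<and> ev_tt z j \<noteq> None)"
    using assms(1)
  proof (induction rule: config_induct)
    case (step D e)
    show ?case
    proof (intro ballI impI)
      fix y assume y: "y \<in> insert e D" "ev_tt y j \<noteq> None"
      show "\<exists>z. cutc n (insert e D) j = Out z j \<and> z \<in> insert e D \<and> y \<in> past z \<and> ev_tt z j \<noteq> None"
      proof (cases "ev_tt e j = None")
        case True
        then show ?thesis using y step.IH cutc_insert[OF step(1-3) jn] by auto
      next
        case False
        then obtain b where b: "b \<in> pre e" "comp b = j" using wfe_ex_pre[OF step(2)] by blast
        then have bD: "cutc n D j = b" using cutc_eqI[OF step(1), of b j] step(3) by blast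
        have "y \<in> past e"
        proof (cases "y = e")
          case False
          then obtain z where "b = Out z j" "y \<in> past z" using y step.IH bD by auto
          then show ?thesis using b(1) pre_Out_past past_trans by blast
        qed simp
        then show ?thesis using False cutc_insert[OF step(1-3) jn] by auto
      qed
    qed
  qed auto
  then show ?thesis using that assms(2,3) by blast
qed

lemma cutc_past:
  assumes "config A n (past e)" "ev_tt e j \<noteq> None"
  shows "cutc n (past e) j = Out e j"
proof -
  obtain z where "cutc n (past e) j = Out z j" "z \<in> past e" "e \<in> past z"
    using cutc_above[OF assms(1) past_self assms(2)] by blast
  then show ?thesis using past_antisym by blast
qed

text \<open>In the configuration \<open>past x \<union> past y\<close> the last j-event lies above
  both \<open>x\<close> and \<open>y\<close>. Since it belongs to one of the two pasts, antisymmetry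
  identifies it with \<open>x\<close> or \<open>y\<close>.\<close>

lemma comparable:
  assumes C: "config A n C" and "x \<in> C" "y \<in> C" "ev_tt x j \<noteq> None" "ev_tt y j \<noteq> None"
  shows "x \<in> past y \<or> y \<in> past x"
proof -
  have sub: "config A n (past x \<union> past y)"
    by (rule config_subset[OF C]) (use assms config_past_subset[OF C] past_trans in blast)+
  obtain z where z: "cutc n (past x \<union> past y) j = Out z j" "z \<in> past x \<union> past y" "x \<in> past z"
    using cutc_above[OF sub, of x j] assms by auto
  moreover obtain z' where "cutc n (past x \<union> past y) j = Out z' j" "y \<in> past z'"
    using cutc_above[OF sub, of y j] assms by auto
  ultimately have "y \<in> past z" by simp
  with z show ?thesis using past_antisym past_trans by blast
qed

text \<open>Going down from \<open>c\<close> along component \<open>i\<close> inside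
  \<open>C - K\<close> ends at the event that consumes the i-condition of the cut of
  \<open>K\<close>, and by absence of conflicts this event is \<open>f\<close>.\<close>

lemma consumer_below:
  assumes C: "config A n C" and K: "config A n K" "K \<subseteq> C"
    and f: "f \<in> C" "cutc n K i \<in> pre f" and "c \<in> C - K" "ev_tt c i \<noteq> None"
  shows "f \<in> past c"
  using assms(6,7)
proof (induction c rule: wf_induct_rule[OF wf_dpred])
  case (1 c)
  have c: "wfe A n c" using config_wfe[OF C] 1 by blast
  obtain b where b: "b \<in> pre c" "comp b = i" using wfe_ex_pre[OF c 1(3)] by blast
  have "b \<in> conds n C" using config_pre[OF C] 1 b by blast
  have "b \<notin> pre d" if "d \<in> K" for d
    using config_conflict_free[OF C] 1(2) that K(2) b(1) by blast
  then have "f \<in> past c" if "b \<in> conds n K"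
    using that cutc_eqI[OF K(1), of b i] b f config_conflict_free[OF C, of f c b] 1(2)
    unfolding cutset_def by auto
  moreover have "f \<in> past c" if bK: "b \<notin> conds n K"
  proof -
    obtain d where d: "b = Out d i" "d \<in> C - K" "ev_tt d i \<noteq> None"
      using bK \<open>b \<in> conds n C\<close> b(2) by (cases b) auto
    then have "(d, c) \<in> dpred" using b(1) unfolding dpred_def by auto
    then show ?thesis using 1(1) d b(1) pre_Out_past past_trans by blast
  qed
  ultimately show ?case by blast
qed

section \<open>Branching processes\<close>

text \<open>The structural facts about a branching process on which the later arguments rest. The
  set \<open>E\<close> itself may contain conflicts; only its local configurations are free of
  them.\<close>

definition bp_closed :: "(nat \<Rightarrow> ('s, 'a) lts) \<Rightarrow> nat \<Rightarrow> ('s, 'a) event set \<Rightarrow> bool" where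
  "bp_closed A n E \<longleftrightarrow> (\<forall>e\<in>E. past e \<subseteq> E \<and> config A n (past e))"

lemma bp_closed_past: "bp_closed A n E \<Longrightarrow> e \<in> E \<Longrightarrow> past e \<subseteq> E"
  and bp_closed_config: "bp_closed A n E \<Longrightarrow> e \<in> E \<Longrightarrow> config A n (past e)"
  and bp_closed_wfe: "bp_closed A n E \<Longrightarrow> e \<in> E \<Longrightarrow> wfe A n e"
  unfolding bp_closed_def using config_wfe past_self by blast+

lemma bp_closed_pre:
  assumes "bp_closed A n E" "e \<in> E" "b \<in> pre e"
  shows "b \<in> conds n E"
  using config_pre[OF bp_closed_config[OF assms(1,2)] past_self assms(3)]
    conds_mono[OF bp_closed_past[OF assms(1,2)]] by blast

lemma config_reach:
  assumes "config A n C" "C \<subseteq> E"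
  shows "reach n E (cutset n C)"
  using assms(1)
proof (induction rule: config_induct)
  case empty
  show ?case by (simp add: cutset_empty reach_init)
next
  case (step D e)
  then show ?case
    using reach_fire[OF step.IH, of e] assms(2) config_insert(3)[OF step(1-3)] by auto
qed

lemma reach_config:
  assumes "reach n E Mk" "\<And>e. e \<in> E \<Longrightarrow> wfe A n e"
  obtains C where "C \<subseteq> E" "config A n C" "Mk = cutset n C"
proof -
  have "\<exists>C \<subseteq> E. config A n C \<and> Mk = cutset n C"
    using assms(1)
  proof (induction rule: reach.induct)
    case reach_init
    then show ?case by (intro exI[of _ "{}"]) (simp add: cutset_empty)
  next
    case (reach_fire Mk e)
    then obtain C where C: "C \<subseteq> E" "config A n C" "Mk = cutset n C" by blast
    show ?case
      using C reach_fire config_insert[OF C(2) assms(2)[of e]] by (intro exI[of _ "insert e C"]) auto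
  qed
  then show ?thesis using that by blast
qed

lemma poss_ext_closed:
  assumes "bp_closed A n E" "poss_ext A n E e"
  shows "bp_closed A n (insert e E)"
proof -
  obtain Mk where e: "wfe A n e" and Mk: "reach n E Mk" "pre e \<subseteq> Mk"
    using assms(2) unfolding poss_ext_def wfe_def by auto
  then obtain C where C: "C \<subseteq> E" "config A n C" "Mk = cutset n C"
    using reach_config bp_closed_wfe[OF assms(1)] by metis
  have ins: "config A n (insert e C)" using config_insert(2)[OF C(2) e] Mk(2) C(3) by blast
  then show ?thesis
    using assms(1) C(1) config_past[OF ins, of e] config_past_subset[OF ins, of e]
    unfolding bp_closed_def by blast
qed

lemma is_bp_closed: "is_bp A n E \<Longrightarrow> finite E \<and> bp_closed A n E"
proof (induction rule: is_bp.induct)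
  case bp_empty
  show ?case by (simp add: bp_closed_def)
next
  case (bp_ext E e)
  then show ?case using poss_ext_closed by blast
qed

text \<open>Turns events of the full unfolding into possible extensions: firing the strict past of
  \<open>e\<close> inside \<open>E\<close> reaches a marking that contains the inputs of
  \<open>e\<close>. This is how termination of the algorithm is exploited later.\<close>

lemma poss_extI:
  assumes e: "config A n (past e)" "past e - {e} \<subseteq> E" "e \<notin> E"
  shows "poss_ext A n E e"
proof -
  define C where "C = past e - {e}"
  have C: "config A n C"
  proof (rule config_subset[OF e(1)])
    show "past x \<subseteq> C" if "x \<in> C" for x
      using that past_trans past_antisym unfolding C_def by blast
  qed (auto simp: C_def)
  have "pre e \<subseteq> cutset n C"
  proof
    fix b assume b: "b \<in> pre e"
    have "b \<in> conds n (past e)" using config_pre[OF e(1) past_self b] .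
    then have "b \<in> conds n C"
      using b pre_Out_neq unfolding C_def by (cases b) auto
    moreover have "b \<notin> pre x" if "x \<in> C" for x
      using config_conflict_free[OF e(1) past_self _ b] that unfolding C_def by blast
    ultimately show "b \<in> cutset n C" unfolding cutset_def by blast
  qed
  moreover have "reach n E (cutset n C)" using config_reach[OF C] e(2) unfolding C_def by blast
  moreover have "wfe A n e" using config_wfe[OF e(1) past_self] .
  ultimately show ?thesis
    using e(3) unfolding poss_ext_def wfe_def by (cases e) auto
qed

section \<open>Notions relative to a process expressed through intrinsic pasts\<close>

lemma flow_rtrancl_past:
  assumes "(u, Inr e) \<in> (flow E)\<^sup>*"
  shows "case u of Inl c \<Rightarrow> \<exists>x\<in>past e. c \<in> pre x | Inr x \<Rightarrow> x \<in> past e"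
  using assms
proof (induction rule: converse_rtrancl_induct)
  case (step u v)
  then show ?case
    unfolding flow_def post_def using pre_Out_past past_trans by fastforce
qed simp

lemma past_flow_rtrancl:
  assumes "bp_closed A n E" "e \<in> E" "x \<in> past e"
  shows "(Inr x, Inr e) \<in> (flow E)\<^sup>*"
proof -
  have "(x, e) \<in> dpred\<^sup>*" using assms(3) unfolding past_def by simp
  then show ?thesis
  proof (induction rule: converse_rtrancl_induct)
    case (step y z)
    then obtain j where j: "Out y j \<in> pre z" unfolding dpred_def by auto
    have z: "z \<in> E" using step.hyps(2) bp_closed_past[OF assms(1,2)] unfolding past_def by blast
    then have "Out y j \<in> conds n E" using bp_closed_pre[OF assms(1)] j by blast
    then have "(Inr y, Inl (Out y j)) \<in> flow E" unfolding flow_def post_def by auto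
    moreover have "(Inl (Out y j), Inr z) \<in> flow E" using z j unfolding flow_def by auto
    ultimately show ?case using step.IH by (meson converse_rtrancl_into_rtrancl)
  qed simp
qed

lemma leq_iff: "bp_closed A n E \<Longrightarrow> e \<in> E \<Longrightarrow> leq E (Inr x) (Inr e) \<longleftrightarrow> x \<in> past e"
  unfolding leq_def using past_flow_rtrancl flow_rtrancl_past by fastforce

lemma less_Inl_imp:
  assumes "less E (Inl b') (Inl b)"
  obtains x y j where "b' \<in> pre x" "x \<in> past y" "b = Out y j"
proof -
  obtain u where u: "(Inl b', u) \<in> (flow E)\<^sup>*" "(u, Inl b) \<in> flow E"
    using assms unfolding less_def by (meson tranclD2)
  then obtain y j where "u = Inr y" "b = Out y j" unfolding flow_def post_def by auto
  then show ?thesis using flow_rtrancl_past[of "Inl b'" y E] u(1) that by auto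
qed

lemma less_Inl_intro:
  assumes E: "bp_closed A n E" "y \<in> E" and "b' \<in> pre x" "x \<in> past y" "ev_tt y j \<noteq> None"
  shows "less E (Inl b') (Inl (Out y j))"
proof -
  have "x \<in> E" using bp_closed_past[OF E] assms(4) by blast
  then have "(Inl b', Inr x) \<in> flow E" using assms(3) unfolding flow_def by auto
  moreover have "(Inr y, Inl (Out y j)) \<in> flow E"
    using E(2) assms(5) unfolding flow_def post_def by auto
  ultimately show ?thesis
    unfolding less_def using past_flow_rtrancl[OF E assms(4)]
    by (meson rtrancl_into_trancl2 rtrancl_trancl_trancl trancl_into_rtrancl rtrancl_into_trancl1 r_into_trancl)
qed

lemma less_iff:
  assumes "bp_closed A n E" "e \<in> E"
  shows "less E (Inr x) (Inr e) \<longleftrightarrow> x \<in> past e \<and> x \<noteq> e"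
proof
  assume "less E (Inr x) (Inr e)"
  then obtain u where u: "(Inr x, u) \<in> flow E" "(u, Inr e) \<in> (flow E)\<^sup>*"
    unfolding less_def by (meson tranclD)
  then obtain j where "u = Inl (Out x j)" unfolding flow_def post_def by auto
  then obtain y where "y \<in> past e" "Out x j \<in> pre y" using flow_rtrancl_past[OF u(2)] by auto
  then show "x \<in> past e \<and> x \<noteq> e"
    using pre_Out_past[of x j y] pre_Out_neq[of x j y] past_trans past_antisym by blast
next
  assume "x \<in> past e \<and> x \<noteq> e"
  then show "less E (Inr x) (Inr e)"
    using past_flow_rtrancl[OF assms, of x] unfolding less_def by (metis Inr_inject rtranclD)
qed

lemma cfg_eq: "bp_closed A n E \<Longrightarrow> e \<in> E \<Longrightarrow> cfg E e = past e"
  unfolding cfg_def using leq_iff bp_closed_past by blast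

lemma mark_eq: "bp_closed A n E \<Longrightarrow> e \<in> E \<Longrightarrow> mark n E e = cutset n (past e)"
  unfolding mark_def cutset_def conds_def by (simp add: cfg_eq)

lemma mcond_eq: "bp_closed A n E \<Longrightarrow> e \<in> E \<Longrightarrow> mcond n E e j = cutc n (past e) j"
  unfolding mcond_def cutc_def by (simp add: mark_eq)

lemma St_eq: "bp_closed A n E \<Longrightarrow> e \<in> E \<Longrightarrow> St A n E e = map (gst A n (past e)) [0..<n]"
  unfolding St_def gst_def by (simp add: mcond_eq)

lemma St_eq_iff:
  assumes "bp_closed A n E" "e \<in> E" "e' \<in> E"
  shows "St A n E e = St A n E e' \<longleftrightarrow> gst A n (past e) = gst A n (past e')"
  unfolding St_eq[OF assms(1,2)] St_eq[OF assms(1,3)] by (auto simp: gst_def fun_eq_iff)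

definition conc :: "('s, 'a) event \<Rightarrow> ('s, 'a) event \<Rightarrow> bool" where
  "conc x y \<longleftrightarrow> x \<notin> past y \<and> y \<notin> past x
     \<and> \<not> (\<exists>e1\<in>past x. \<exists>e2\<in>past y. e1 \<noteq> e2 \<and> pre e1 \<inter> pre e2 \<noteq> {})"

text \<open>The order on conditions is unfolded: \<open>b'\<close> is below \<open>b\<close> if a
  consumer \<open>x\<close> of \<open>b'\<close> is at or below the producer \<open>y\<close> of
  \<open>b\<close>.\<close>

definition strong :: "nat \<Rightarrow> ('s, 'a) event \<Rightarrow> ('s, 'a) event \<Rightarrow> bool" where
  "strong n e' e \<longleftrightarrow> e' \<in> past e \<and> e' \<noteq> e \<and>
     (\<forall>b \<in> cutset n (past e) - cutset n (past e'). \<forall>b' \<in> cutset n (past e') - cutset n (past e).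
        \<exists>x y j. b' \<in> pre x \<and> x \<in> past y \<and> b = Out y j)"

lemma concurrent_iff:
  assumes "bp_closed A n E" "x \<in> E" "y \<in> E"
  shows "concurrent E (Inr x) (Inr y) \<longleftrightarrow> conc x y"
proof -
  have "conflict E (Inr x) (Inr y) \<longleftrightarrow> (\<exists>e1\<in>past x. \<exists>e2\<in>past y. e1 \<noteq> e2 \<and> pre e1 \<inter> pre e2 \<noteq> {})"
    unfolding conflict_def leq_iff[OF assms(1,2)] leq_iff[OF assms(1,3)]
    using bp_closed_past[OF assms(1,2)] bp_closed_past[OF assms(1,3)] by blast
  then show ?thesis
    unfolding concurrent_def conc_def leq_iff[OF assms(1,2)] leq_iff[OF assms(1,3)] by blast
qed

lemma scause_iff:
  assumes E: "bp_closed A n E" "e \<in> E"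
  shows "scause n E e' e \<longleftrightarrow> strong n e' e"
proof (cases "e' \<in> past e \<and> e' \<noteq> e")
  case True
  then have e': "e' \<in> E" using bp_closed_past[OF E] by blast
  have "less E (Inl b') (Inl b) \<longleftrightarrow> (\<exists>x y j. b' \<in> pre x \<and> x \<in> past y \<and> b = Out y j)"
    if b: "b \<in> cutset n (past e)" for b b'
  proof
    assume "less E (Inl b') (Inl b)"
    then show "\<exists>x y j. b' \<in> pre x \<and> x \<in> past y \<and> b = Out y j" by (meson less_Inl_imp)
  next
    assume "\<exists>x y j. b' \<in> pre x \<and> x \<in> past y \<and> b = Out y j"
    then obtain x y j where xy: "b' \<in> pre x" "x \<in> past y" "b = Out y j" by blast
    with b have "y \<in> past e" "ev_tt y j \<noteq> None" unfolding cutset_def by auto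
    then show "less E (Inl b') (Inl b)"
      using less_Inl_intro[OF E(1) _ xy(1,2)] bp_closed_past[OF E] xy(3) by blast
  qed
  then show ?thesis
    using True unfolding scause_def strong_def less_iff[OF E] mark_eq[OF E] mark_eq[OF E(1) e']
    by auto
next
  case False
  then show ?thesis unfolding scause_def strong_def less_iff[OF E] by blast
qed

lemma Con_eq:
  assumes "bp_closed A n (insert e E)"
  shows "Con i E co e = {x\<in>E. ievent i x \<and> x \<notin> co \<and> conc x e}"
  unfolding Con_def using concurrent_iff[OF assms] by blast

lemma is_cutoff_iff:
  assumes "bp_closed A n (insert e E)"
  shows "is_cutoff A n i E e \<longleftrightarrow>
    ievent i e \<and> (\<exists>e'\<in>E. ievent i e' \<and> gst A n (past e) = gst A n (past e'))"
  unfolding is_cutoff_def using St_eq_iff[OF assms] by blast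

text \<open>Covers both uses of the test: for a new event, and for an event already in
  \<open>E\<close> when it may be freed.\<close>

lemma is_cand_iff:
  assumes "bp_closed A n E" "bp_closed A n (insert e E)"
  shows "is_cand A n i E co e \<longleftrightarrow> \<not> ievent i e \<and>
     (\<exists>e'\<in>E. strong n e' e \<and> gst A n (past e) = gst A n (past e')
        \<and> cutc n (past e') i = cutc n (past e) i
        \<and> {x\<in>E. ievent i x \<and> x \<notin> co \<and> conc x e} \<subseteq> {x\<in>E. ievent i x \<and> x \<notin> co \<and> conc x e'})"
proof -
  have "Con i E co e' = {x\<in>E. ievent i x \<and> x \<notin> co \<and> conc x e'}" if "e' \<in> E" for e'
    using Con_eq[of A n e' E] assms(1) that by (simp add: insert_absorb)
  then show ?thesis
    unfolding is_cand_def Con_eq[OF assms(2)]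
    using scause_iff[OF assms(2)] St_eq_iff[OF assms(2)] mcond_eq[OF assms(2)]
    by (metis (no_types, lifting) insertI1 insertI2)
qed

section \<open>Invariants of the algorithm\<close>

text \<open>Marked events are maximal in \<open>E\<close>, since nothing is ever added above them
  while they are marked. The clause on companions supplies representatives outside
  \<open>co\<close>, from which completeness can continue. The injectivity clause bounds the number
  of i-events that are not cut-offs, as termination requires.\<close>

definition alg_inv :: "(nat \<Rightarrow> ('s, 'a) lts) \<Rightarrow> nat \<Rightarrow> nat \<Rightarrow> ('s, 'a) alg_state \<Rightarrow> bool" where
  "alg_inv A n i st = (case st of (E, co, coc) \<Rightarrow>
     is_bp A n E \<and> co \<subseteq> E \<and> coc \<subseteq> E \<and> (\<forall>e\<in>co. ievent i e)
     \<and> (\<forall>e\<in>E. \<forall>x\<in>past e. x \<in> co \<union> coc \<longrightarrow> x = e)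
     \<and> (\<forall>e\<in>E. ievent i e \<longrightarrow> (\<exists>e'\<in>E - co. ievent i e' \<and> gst A n (past e) = gst A n (past e')))
     \<and> inj_on (\<lambda>e. gst A n (past e)) {e\<in>E - co. ievent i e}
     \<and> (\<forall>c\<in>coc. is_cand A n i E co c))"

lemma alg_inv_start: "alg_inv A n i alg_start"
  unfolding alg_inv_def alg_start_def by (auto intro: bp_empty)

text \<open>The process enters a candidate test in two ways: as a supply of strong causes, where
  growth only helps, and through its non-cut-off i-events, which are assumed unchanged.\<close>

lemma is_cand_mono:
  assumes "bp_closed A n E" "bp_closed A n E'" "bp_closed A n (insert c E)" "c \<in> E'" "E \<subseteq> E'" "is_cand A n i E co c"
    and "{x\<in>E'. ievent i x \<and> x \<notin> co'} = {x\<in>E. ievent i x \<and> x \<notin> co}"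
  shows "is_cand A n i E' co' c"
proof -
  have 1: "insert c E' = E'" using assms(4) by auto
  have 2: "{x\<in>E'. ievent i x \<and> x \<notin> co' \<and> P x} = {x\<in>E. ievent i x \<and> x \<notin> co \<and> P x}" for P
    using assms(7) by blast
  show ?thesis
    unfolding is_cand_iff[of A n E' c i co', unfolded 1, OF assms(2,2)] 2
    using assms(6)[unfolded is_cand_iff[OF assms(1,3)]] assms(5) by blast
qed

lemma alg_step_cases:
  assumes "alg_step A n i (E, co, coc) st'"
  obtains e E' co' coc' where "st' = (E', co', coc')" "E' = insert e E" "eligible A n (E, co, coc) e"
    "is_cutoff A n i E e \<and> co' = insert e co \<and> coc' = coc \<or>
     \<not> is_cutoff A n i E e \<and> is_cand A n i E co e \<and> co' = co \<and> coc' = insert e coc \<or>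
     \<not> is_cutoff A n i E e \<and> \<not> is_cand A n i E co e \<and> co' = co \<and>
       coc' = coc - {ec \<in> coc. frees A n i E co e ec}"
  using assms unfolding alg_step_def by (auto split: if_splits)

lemma alg_inv_step:
  assumes inv: "alg_inv A n i (E, co, coc)" and step: "alg_step A n i (E, co, coc) st'"
  shows "alg_inv A n i st'"
proof -
  obtain e E' co' coc' where st': "st' = (E', co', coc')" and E': "E' = insert e E"
    and el: "eligible A n (E, co, coc) e"
    and cases: "is_cutoff A n i E e \<and> co' = insert e co \<and> coc' = coc \<or>
     \<not> is_cutoff A n i E e \<and> is_cand A n i E co e \<and> co' = co \<and> coc' = insert e coc \<or>
     \<not> is_cutoff A n i E e \<and> \<not> is_cand A n i E co e \<and> co' = co \<and>
       coc' = coc - {ec \<in> coc. frees A n i E co e ec}"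
    by (rule alg_step_cases[OF step])
  have bp: "is_bp A n E" and sub: "co \<subseteq> E" "coc \<subseteq> E" and coi: "\<And>e. e \<in> co \<Longrightarrow> ievent i e"
    and pst: "\<And>e x. e \<in> E \<Longrightarrow> x \<in> past e \<Longrightarrow> x \<in> co \<union> coc \<Longrightarrow> x = e"
    and comp: "\<And>e. e \<in> E \<Longrightarrow> ievent i e \<Longrightarrow>
      \<exists>e'\<in>E - co. ievent i e' \<and> gst A n (past e) = gst A n (past e')"
    and inj: "inj_on (\<lambda>e. gst A n (past e)) {e\<in>E - co. ievent i e}"
    and cand: "\<And>c. c \<in> coc \<Longrightarrow> is_cand A n i E co c"
    using inv unfolding alg_inv_def by auto
  have ext: "poss_ext A n E e" using el unfolding eligible_def by simp
  then have new: "e \<notin> E" unfolding poss_ext_def by blast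
  have bp': "is_bp A n E'" unfolding E' using bp_ext[OF bp ext] .
  note cl = is_bp_closed[OF bp, THEN conjunct2] and cl' = is_bp_closed[OF bp', THEN conjunct2]
  note cutoff = is_cutoff_iff[OF cl'[unfolded E']]
  have cut_ie: "ievent i e" if "is_cutoff A n i E e" using that cutoff by blast
  have nco: "{x\<in>E' - co'. ievent i x} = {x\<in>E - co. ievent i x} \<union>
      (if ievent i e \<and> \<not> is_cutoff A n i E e then {e} else {})"
    using cases cut_ie new sub unfolding E' by auto
  have "co' \<subseteq> E'" "coc' \<subseteq> E'" "\<forall>e\<in>co'. ievent i e"
    using cases sub coi cut_ie unfolding E' by auto
  moreover have "x = f" if "f \<in> E'" "x \<in> past f" "x \<in> co' \<union> coc'" for f x
  proof (cases "f = e")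
    case True
    show ?thesis
    proof (rule ccontr)
      assume "x \<noteq> f"
      then have "less (insert e E) (Inr x) (Inr e)"
        using less_iff[OF cl'[unfolded E'], of e x] that True by auto
      then have "x \<notin> co \<union> coc" using el unfolding eligible_def by auto
      then show False using that cases \<open>x \<noteq> f\<close> True by auto
    qed
  next
    case False
    then have "f \<in> E" using that E' by auto
    then have "x \<in> E" using bp_closed_past[OF cl] that by blast
    then have "x \<in> co \<union> coc" using that(3) cases new by auto
    then show ?thesis using pst \<open>f \<in> E\<close> that by blast
  qed
  moreover have "\<exists>e'\<in>E' - co'. ievent i e' \<and> gst A n (past f) = gst A n (past e')"
    if f: "f \<in> E'" "ievent i f" for f
  proof -
    have old: "\<exists>e'\<in>E' - co'. ievent i e' \<and> gst A n (past g) = gst A n (past e')"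
      if "g \<in> E" "ievent i g" for g
      using comp[OF that] nco by blast
    show ?thesis
    proof (cases "f \<in> E")
      case True
      then show ?thesis using old f by blast
    next
      case False
      then have "f = e" using f E' by blast
      show ?thesis
      proof (cases "is_cutoff A n i E e")
        case True
        \<comment> \<open>The companion found by the test may itself be a cut-off; the clause for
          older events leads on to one that is not.\<close>
        then show ?thesis using cutoff old \<open>f = e\<close> by metis
      next
        case False
        then show ?thesis using nco f \<open>f = e\<close> by auto
      qed
    qed
  qed
  moreover have "inj_on (\<lambda>e. gst A n (past e)) {e\<in>E' - co'. ievent i e}"
    unfolding nco using inj cutoff by (auto simp: inj_on_Un)
  moreover have "is_cand A n i E' co' c" if c: "c \<in> coc'" for c
  \<comment> \<open>Only a new i-event that is not a cut-off changes the sets compared by candidate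
    tests. It is not a candidate, so the algorithm takes the branch that removes whatever it
    frees.\<close>
  proof (cases "ievent i e \<and> \<not> is_cutoff A n i E e")
    case True
    then have "\<not> is_cand A n i E co e" unfolding is_cand_def by blast
    then have "c \<in> coc" "\<not> frees A n i E co e c" "co' = co" using True cases c by auto
    then show ?thesis using cand unfolding frees_def E' by blast
  next
    case False
    have nco': "{x\<in>E'. ievent i x \<and> x \<notin> co'} = {x\<in>E. ievent i x \<and> x \<notin> co}"
      using nco[unfolded if_not_P[OF False]] by blast
    have "c \<in> E'" "is_cand A n i E co c" "bp_closed A n (insert c E)"
      using c cases cand[of c] sub cl cl' insert_absorb[of c E] unfolding E' by auto
    then show ?thesis
      using is_cand_mono[OF cl cl' _ _ _ _ nco'] subset_insertI[of E e] unfolding E' by blast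
  qed
  ultimately show ?thesis using bp' unfolding alg_inv_def st' by auto
qed

lemma alg_inv_reachable: "(alg_step A n i)\<^sup>*\<^sup>* alg_start st \<Longrightarrow> alg_inv A n i st"
proof (induction rule: rtranclp_induct)
  case base
  show ?case by (rule alg_inv_start)
next
  case (step st st')
  then show ?case using alg_inv_step by (cases st) blast
qed

section \<open>The folding simulates and is simulated by the product\<close>

text \<open>Extends \<open>past\<close> to conditions, so that every state of the interface
  projection, including the initial one, determines a global state.\<close>

definition base :: "('s, 'a) cond \<Rightarrow> ('s, 'a) event set" where
  "base b = (case b of Init j \<Rightarrow> {} | Out e j \<Rightarrow> past e)"

lemma equiv_Inter:
  assumes "\<And>Q. Q \<in> \<Q> \<Longrightarrow> equiv X Q" "\<Q> \<noteq> {}"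
  shows "equiv X (\<Inter> \<Q>)"
proof (rule equivI)
  show "\<Inter> \<Q> \<subseteq> X \<times> X" using assms equiv_type by blast
  show "refl_on X (\<Inter> \<Q>)"
    using assms(1) unfolding equiv_def refl_on_def by blast
  show "sym (\<Inter> \<Q>)"
    using assms(1) unfolding equiv_def sym_def by blast
  show "Relation.trans (\<Inter> \<Q>)"
  proof (rule transI)
    fix x y z assume "(x, y) \<in> \<Inter> \<Q>" "(y, z) \<in> \<Inter> \<Q>"
    then show "(x, z) \<in> \<Inter> \<Q>" using assms(1) unfolding equiv_def by (meson InterE InterI transE)
  qed
qed

lemma base_config:
  assumes "bp_closed A n E" "b \<in> iconds n i E"
  shows "config A n (base b)" "cutc n (base b) i = b"
  using assms bp_closed_config[OF assms(1)] cutc_past[of A n _ i] cutc_empty[of i n]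
  unfolding iconds_def base_def by (cases b; force)+

lemma mcond_ievent:
  assumes "bp_closed A n E" "e \<in> E" "ievent i e"
  shows "mcond n E e i = Out e i"
  using mcond_eq[OF assms(1,2)] cutc_past[OF bp_closed_config[OF assms(1,2)]] assms(3)
  unfolding ievent_def by metis

lemma Out_iconds: "e \<in> E \<Longrightarrow> ievent i e \<Longrightarrow> Out e i \<in> iconds n i E"
  unfolding iconds_def ievent_def by simp

text \<open>Having equal global states is one of the relations over which \<open>fold_eq\<close> is
  the intersection. This gives the second claim, and it makes the family nonempty, as
  \<open>equiv_Inter\<close> demands.\<close>

lemma fold_eq_props:
  assumes E: "bp_closed A n E" and co: "co \<subseteq> E" "\<And>e. e \<in> co \<Longrightarrow> ievent i e"
  shows "equiv (iconds n i E) (fold_eq A n i E co)"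
    and "(b, b') \<in> fold_eq A n i E co \<Longrightarrow> gst A n (base b) = gst A n (base b')"
proof -
  define \<Q> where "\<Q> = {Q. equiv (iconds n i E) Q \<and>
    (\<forall>e\<in>co. \<forall>e'\<in>E. ievent i e' \<and> St A n E e = St A n E e' \<longrightarrow> (mcond n E e i, mcond n E e' i) \<in> Q)}"
  define Q0 where "Q0 = {(b, b') \<in> iconds n i E \<times> iconds n i E. gst A n (base b) = gst A n (base b')}"
  have "equiv (iconds n i E) Q0"
    unfolding Q0_def by (rule equivI) (auto simp: refl_on_def sym_def Relation.trans_def)
  moreover have "(mcond n E e i, mcond n E e' i) \<in> Q0"
    if e: "e \<in> co" "e' \<in> E" "ievent i e'" "St A n E e = St A n E e'" for e e'
  proof -
    have e': "e \<in> E" "ievent i e" using e co by auto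
    have "gst A n (past e) = gst A n (past e')" using e St_eq_iff[OF E e'(1)] by blast
    then show ?thesis
      unfolding mcond_ievent[OF E e'] mcond_ievent[OF E e(2,3)] Q0_def
      using Out_iconds e' e by (auto simp: base_def)
  qed
  ultimately have Q0: "Q0 \<in> \<Q>" unfolding \<Q>_def by blast
  have f: "fold_eq A n i E co = \<Inter> \<Q>" unfolding fold_eq_def \<Q>_def ..
  show "equiv (iconds n i E) (fold_eq A n i E co)"
    unfolding f by (rule equiv_Inter) (use Q0 in \<open>auto simp: \<Q>_def\<close>)
  show "gst A n (base b) = gst A n (base b')" if "(b, b') \<in> fold_eq A n i E co"
    using that Q0 unfolding f Q0_def by blast
qed

lemma fold_eq_companion:
  assumes E: "bp_closed A n E" and "e \<in> co" "e \<in> E" "ievent i e" "e' \<in> E" "ievent i e'"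
    and "gst A n (past e) = gst A n (past e')"
  shows "(Out e i, Out e' i) \<in> fold_eq A n i E co"
proof -
  have "St A n E e = St A n E e'" using St_eq_iff[OF E] assms by blast
  then show ?thesis
    using assms(2,5,6) unfolding fold_eq_def
      mcond_ievent[OF E assms(3,4), symmetric] mcond_ievent[OF E assms(5,6), symmetric] by blast
qed

text \<open>The events between \<open>base b\<close> and \<open>past e\<close> spell some word of
  the product. The history of \<open>Out e i\<close> is unique and extends that of \<open>b\<close>
  by \<open>ev_act e\<close>, so this is the only visible action of the word.\<close>

lemma segment_path:
  assumes E: "bp_closed A n E" and e: "e \<in> E" "ievent i e" "b \<in> pre e" "comp b = i"
  shows "\<exists>u. path (prod_rel A n) (gst A n (base b)) u (gst A n (past e)) \<and>
    filter (\<lambda>a. a \<in> acts (A i)) u = [ev_act e]"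
proof -
  have i: "i < n" using wfe_tt_less[OF bp_closed_wfe[OF E e(1)]] e(2) unfolding ievent_def by blast
  have "b \<in> iconds n i E" using bp_closed_pre[OF E e(1,3)] e(4) unfolding iconds_def by blast
  note b = base_config[OF E this]
  have sub: "base b \<subseteq> past e"
    using e(3) pre_Out_past past_trans unfolding base_def by (cases b) (auto, blast)
  obtain w where w: "hist i b w" using config_hist_ex[OF b(1) i] unfolding b(2) .
  obtain u where u: "path (prod_rel A n) (gst A n (base b)) u (gst A n (past e))"
    "hist i (cutc n (past e) i) (w @ filter (\<lambda>a. a \<in> acts (A i)) u)"
    using config_path[OF bp_closed_config[OF E e(1)] b(1) sub i] w unfolding b(2) by blast
  have "cutc n (past e) i = Out e i"
    using cutc_past[OF bp_closed_config[OF E e(1)]] e(2) unfolding ievent_def by blast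
  moreover have "hist i (Out e i) (w @ [ev_act e])"
    using hist_Out[OF e(3,4) wfe_inj[OF bp_closed_wfe[OF E e(1)]] w] .
  ultimately show ?thesis using u hist_unique by fastforce
qed

lemma Tr_fold_sound:
  assumes E: "bp_closed A n E" and co: "co \<subseteq> E" "\<And>e. e \<in> co \<Longrightarrow> ievent i e" and i: "i < n"
  shows "Tr_fold A n i E co \<subseteq> proj (acts (A i)) ` Tr_prod A n"
proof -
  let ?Q = "fold_eq A n i E co"
  note Q = fold_eq_props[where co = co, OF E co]
  \<comment> \<open>The choice of representative is harmless, as equivalent conditions have the same
    global state.\<close>
  define h where "h q = gst A n (base (SOME b. b \<in> q))" for q
  have h: "h (?Q `` {b}) = gst A n (base b)" if "b \<in> iconds n i E" for b
  proof -
    have "b \<in> ?Q `` {b}" using equiv_class_self[OF Q(1) that] .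
    then have "(SOME c. c \<in> ?Q `` {b}) \<in> ?Q `` {b}" by (rule someI)
    then show ?thesis unfolding h_def using Q(2) by (metis Image_singleton_iff)
  qed
  have "\<exists>u. path (prod_rel A n) (h q) u (h q') \<and> filter (\<lambda>a. a \<in> acts (A i)) u = [a]"
    if step: "(q, a, q') \<in> fold_rel A n i E co" for q a q'
  proof -
    obtain b e where e: "q = ?Q `` {b}" "q' = ?Q `` {Out e i}" "a = ev_act e" "e \<in> E" "ievent i e"
      "b \<in> pre e" "comp b = i"
      using step unfolding fold_rel_def iproj_rel_def by blast
    have "b \<in> iconds n i E" using bp_closed_pre[OF E e(4,6)] e(7) unfolding iconds_def by blast
    then show ?thesis
      using segment_path[OF E e(4-7)] h Out_iconds[OF e(4,5)] e(1-3) by (simp add: base_def)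
  qed
  moreover have "h (fold_init A n i E co) = prod_init A n"
    using h[of "Init i"] i unfolding fold_init_def by (simp add: iconds_def base_def gst_empty)
  ultimately show ?thesis
    using weak_sim_traces[of "fold_rel A n i E co" "prod_rel A n" h "acts (A i)" "fold_init A n i E co"]
    unfolding Tr_fold_def Tr_prod_def by simp
qed

section \<open>Completeness of the folding\<close>

lemma rtrancl_boundary:
  assumes "(x, y) \<in> r\<^sup>*" "P x" "\<not> P y"
  obtains u v where "(x, u) \<in> r\<^sup>*" "P u" "(u, v) \<in> r" "\<not> P v" "(v, y) \<in> r\<^sup>*"
proof -
  have "\<exists>u v. (x, u) \<in> r\<^sup>* \<and> P u \<and> (u, v) \<in> r \<and> \<not> P v \<and> (v, y) \<in> r\<^sup>*"
    using assms
  proof (induction rule: converse_rtrancl_induct)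
    case (step x z)
    show ?case
    proof (cases "P z")
      case True
      then show ?thesis using step by (meson converse_rtrancl_into_rtrancl)
    next
      case False
      then show ?thesis using step by blast
    qed
  qed simp
  then show ?thesis using that by blast
qed

text \<open>This is where strong causality matters: an event concurrent with a candidate and with its
  strong cause cannot depend on anything that happens between the two.\<close>

lemma strong_conc_past:
  assumes C: "config A n C" "c \<in> C" "x \<in> C" and conc: "conc x c" "conc x c'" and strong: "strong n c' c"
  shows "past x \<inter> past c \<subseteq> past c'"
proof (rule ccontr)
  assume "\<not> ?thesis"
  then obtain d where d: "d \<in> past x" "d \<in> past c" "d \<notin> past c'" by blast
  have c': "c' \<in> past c" "c' \<noteq> c" using strong unfolding strong_def by auto
  have subs: "past x \<subseteq> C" "past c \<subseteq> C" using config_past_subset C by blast+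
  have "x \<notin> past c" using conc unfolding conc_def by blast
  \<comment> \<open>Where the causal path from \<open>d\<close> to \<open>x\<close> leaves
    \<open>past c\<close>, it crosses a condition \<open>Out y k\<close> that is in the cut of
    \<open>past c\<close> but not in that of \<open>past c'\<close>.\<close>
  then obtain y z where yz: "(d, y) \<in> dpred\<^sup>*" "y \<in> past c" "(y, z) \<in> dpred" "z \<notin> past c" "z \<in> past x"
    using rtrancl_boundary[of d x dpred "\<lambda>v. v \<in> past c"] d unfolding past_def by blast
  then obtain k where k: "Out y k \<in> pre z" unfolding dpred_def by auto
  have "y \<notin> past c'" using d(3) yz(1) past_trans unfolding past_def by blast
  have "Out y k \<in> conds n C" using config_pre[OF C(1) _ k] yz(5) subs by blast
  then have "Out y k \<in> cutset n (past c) - cutset n (past c')"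
    using yz(2,4,5) k config_conflict_free[OF C(1), of z _ "Out y k"] subs \<open>y \<notin> past c'\<close>
    unfolding cutset_def by auto
  \<comment> \<open>Conversely, as \<open>c'\<close> is strictly below \<open>c\<close>, one of its
    outputs is consumed within \<open>past c\<close>.\<close>
  moreover obtain l where "Out c' l \<in> cutset n (past c') - cutset n (past c)"
  proof -
    have "(c', c) \<in> dpred\<^sup>+" using c' unfolding past_def by (auto dest: rtranclD)
    then obtain v where v: "(c', v) \<in> dpred" "v \<in> past c" unfolding past_def by (auto dest: tranclD)
    then obtain l where l: "Out c' l \<in> pre v" unfolding dpred_def by auto
    have "Out c' l \<in> conds n C" using config_pre[OF C(1) _ l] v(2) subs by blast
    moreover have "Out c' l \<notin> pre w" if "w \<in> past c'" for w
      using that pre_Out_past[of c' l w] pre_Out_neq[of c' l w] past_antisym by blast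
    ultimately show ?thesis using that[of l] l v(2) unfolding cutset_def by auto
  qed
  \<comment> \<open>Strong causality orders these two conditions, which puts \<open>c'\<close> below
    \<open>y\<close> and hence below \<open>x\<close>, against their concurrency.\<close>
  ultimately obtain x1 y1 j where "Out c' l \<in> pre x1" "x1 \<in> past y1" "Out y k = Out y1 j"
    using strong unfolding strong_def by blast
  then have "c' \<in> past x" using pre_Out_past[OF k] yz(5) pre_Out_past past_trans by (metis cond.inject(2))
  then show False using conc unfolding conc_def by blast
qed

text \<open>Consider one component. If its condition in the cut of the larger union already exists
  in the smaller one, it is current there too. Otherwise the component moved between
  \<open>c'\<close> and \<open>c\<close>. By \<open>strong_conc_past\<close> its condition in the
  cut of \<open>past c'\<close> is not consumed in \<open>past x\<close>, so the two unions show the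
  component as it is after \<open>c'\<close> and after \<open>c\<close>, where the labels
  agree.\<close>

lemma strong_conc_gst:
  assumes C: "config A n C" "c \<in> C" "x \<in> C" and conc: "conc x c" "conc x c'" and strong: "strong n c' c"
    and gst: "gst A n (past c) = gst A n (past c')"
  shows "gst A n (past c' \<union> past x) = gst A n (past c \<union> past x)"
proof
  fix j
  show "gst A n (past c' \<union> past x) j = gst A n (past c \<union> past x) j"
  proof (cases "j < n")
    case False
    then show ?thesis unfolding gst_def by simp
  next
    case j: True
    have c': "past c' \<subseteq> past c" using strong past_trans unfolding strong_def by blast
    have subs: "past x \<subseteq> C" "past c \<subseteq> C" using config_past_subset C by blast+
    let ?L = "past c \<union> past x" and ?L' = "past c' \<union> past x"
    have L: "config A n ?L"
      by (rule config_subset[OF C(1)]) (use subs past_trans in blast)+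
    have L': "config A n ?L'"
      by (rule config_subset[OF C(1)]) (use subs c' past_trans in blast)+
    have cc: "config A n (past c)" "config A n (past c')"
      using config_past C(1) subs c' past_self by blast+
    define b where "b = cutc n ?L j"
    have b: "b \<in> cutset n ?L" "comp b = j" using cutc_in[OF L j] unfolding b_def by auto
    have same: "cutc n ?L' j = b" if "b \<in> conds n ?L'"
      using that b c' cutc_eqI[OF L', of b j] unfolding cutset_def by blast
    show ?thesis
    proof (cases "b \<in> conds n ?L'")
      case True
      then show ?thesis using same unfolding gst_def b_def by simp
    next
      case False
      then have bc: "b \<in> conds n (past c)"
        using b(1) unfolding cutset_def by (cases b) auto
      then have "b \<in> cutset n (past c)" using b(1) unfolding cutset_def by auto
      then have cb: "cutc n (past c) j = b" using cutc_eqI[OF cc(1)] b(2) by blast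
      define b' where "b' = cutc n (past c') j"
      have b': "b' \<in> cutset n (past c')" "comp b' = j"
        using cutc_in[OF cc(2) j] unfolding b'_def by auto
      have "b' \<in> conds n ?L'" using b'(1) conds_mono[of "past c'" ?L' n] unfolding cutset_def by blast
      then have "b' \<noteq> b" using False by blast
      then have nb': "b' \<notin> cutset n (past c)" using cutc_eqI[OF cc(1) _ b'(2)] cb by blast
      have "b' \<in> conds n (past c)"
        using b'(1) conds_mono[OF c', of n] unfolding cutset_def by blast
      then obtain y where y: "y \<in> past c" "b' \<in> pre y" using nb' unfolding cutset_def by blast
      have "b' \<notin> pre z" if z: "z \<in> ?L'" for z
      proof
        assume bz: "b' \<in> pre z"
        then have "z = y" using config_conflict_free[OF C(1), of z y b'] y z subs c' by blast
        moreover have "z \<notin> past c'" using bz b'(1) unfolding cutset_def by blast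
        ultimately show False
          using strong_conc_past[OF C conc strong] y(1) z by blast
      qed
      then have "b' \<in> cutset n ?L'" using \<open>b' \<in> conds n ?L'\<close> unfolding cutset_def by blast
      then have "cutc n ?L' j = b'" using cutc_eqI[OF L'] b'(2) by blast
      moreover have "clab A b' = clab A b"
        using fun_cong[OF gst, of j] j cb unfolding gst_def b'_def by simp
      ultimately show ?thesis using j unfolding gst_def b_def by simp
    qed
  qed
qed

text \<open>The history is split into \<open>w\<close> before \<open>K\<close> and \<open>v\<close>
  after it because a companion has a different \<open>w\<close>; only the remaining word
  \<open>v\<close> has to be read by the folding.\<close>

lemma fold_complete:
  assumes inv: "alg_inv A n i (E, co, coc)" and final: "alg_final A n (E, co, coc)" and i: "i < n"
    and K: "K = {} \<or> (\<exists>x\<in>E - co. ievent i x \<and> K = past x)"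
    and C: "config A n C" "K \<subseteq> C"
    and w: "hist i (cutc n K i) w" "hist i (cutc n C i) (w @ v)"
  shows "\<exists>q. path (fold_rel A n i E co) (fold_eq A n i E co `` {cutc n K i}) v q"
  using K C w
proof (induction "card (C - K)" arbitrary: C K v w rule: less_induct)
  case less
  have bp: "is_bp A n E" and sub: "co \<subseteq> E" "coc \<subseteq> E" and coi: "\<And>e. e \<in> co \<Longrightarrow> ievent i e"
    and pst: "\<And>e x. e \<in> E \<Longrightarrow> x \<in> past e \<Longrightarrow> x \<in> co \<union> coc \<Longrightarrow> x = e"
    and comp: "\<And>e. e \<in> E \<Longrightarrow> ievent i e \<Longrightarrow>
      \<exists>e'\<in>E - co. ievent i e' \<and> gst A n (past e) = gst A n (past e')"
    and cand: "\<And>c. c \<in> coc \<Longrightarrow> is_cand A n i E co c"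
    using inv unfolding alg_inv_def by auto
  note E = is_bp_closed[OF bp, THEN conjunct2]
  note C = less.prems(2) and KC = less.prems(3)
  let ?Q = "fold_eq A n i E co" and ?b = "cutc n K i"
  have K: "config A n K"
    using less.prems(1) bp_closed_config[OF E] config_empty by blast
  have finC: "finite C" using config_finite[OF C] .
  have b: "?b \<in> cutset n K" "comp ?b = i" using cutc_in[OF K i] by auto
  have bK: "?b \<in> conds n K" using b(1) unfolding cutset_def by blast
  show ?case
  proof (cases "?b \<in> cutset n C")
    case True
    then have "cutc n C i = ?b" using cutc_eqI[OF C _ b(2)] by blast
    then have "w @ v = w" using hist_unique[OF less.prems(5)] less.prems(4) by simp
    then show ?thesis by auto
  next
    case False
    then obtain f where f: "f \<in> C" "?b \<in> pre f"
      using conds_mono[OF KC, of n] bK unfolding cutset_def by blast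
    have fK: "f \<notin> K" using b(1) f(2) unfolding cutset_def by blast
    have wf: "wfe A n f" using config_wfe[OF C f(1)] .
    have fi: "ievent i f" using wfe_pre(2)[OF wf f(2)] b(2) unfolding ievent_def by simp
    have pf: "config A n (past f)" "past f \<subseteq> C"
      using config_past[OF C f(1)] config_past_subset[OF C f(1)] by auto
    have K_cases: "K = {} \<or> (\<exists>x. x \<in> E - co \<and> ievent i x \<and> K = past x \<and> ?b = Out x i)"
      using less.prems(1) K cutc_past[of A n _ i] unfolding ievent_def by blast
    have Kf: "K \<subseteq> past f"
    proof
      fix y assume "y \<in> K"
      then obtain x where "y \<in> past x" "Out x i \<in> pre f" using K_cases f(2) by auto
      then show "y \<in> past f" using pre_Out_past past_trans by blast
    qed
    have hf: "hist i (cutc n (past f) i) (w @ [ev_act f])"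
      using hist_Out[OF f(2) b(2) wfe_inj[OF wf] less.prems(4)] cutc_past[OF pf(1)] fi
      unfolding ievent_def by metis
    show ?thesis
    proof (cases "f \<in> E")
      case True
      obtain u where u: "path (prod_rel A n) (gst A n (past f)) u (gst A n C)"
        "card C = card (past f) + length u"
        "hist i (cutc n C i) ((w @ [ev_act f]) @ filter (\<lambda>a. a \<in> acts (A i)) u)"
        using config_path[OF C pf(1,2) i hf] .
      define v' where "v' = filter (\<lambda>a. a \<in> acts (A i)) u"
      have v: "v = ev_act f # v'" using hist_unique[OF u(3) less.prems(5)] unfolding v'_def by simp
      \<comment> \<open>The step to \<open>Out f i\<close> may enter a cut-off, but the same state
        of the folding contains an output of the non-cut-off \<open>f'\<close>, at which the
        induction can go on.\<close>
      obtain f' where f': "f' \<in> E - co" "ievent i f'" "gst A n (past f) = gst A n (past f')"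
        "?Q `` {Out f i} = ?Q `` {Out f' i}"
      proof (cases "f \<in> co")
        case fco: True
        obtain f' where f': "f' \<in> E - co" "ievent i f'" "gst A n (past f) = gst A n (past f')"
          using comp[OF True fi] by blast
        then have "(Out f i, Out f' i) \<in> ?Q"
          using fold_eq_companion[OF E fco True fi] by blast
        then show ?thesis
          using that[OF f'] equiv_class_eq[OF fold_eq_props(1)[OF E sub(1) coi]] by blast
      next
        case False
        then show ?thesis using that[of f] True fi by blast
      qed
      have pf': "config A n (past f')" using bp_closed_config[OF E] f'(1) by blast
      obtain w' where w': "hist i (cutc n (past f') i) w'" using config_hist_ex[OF pf' i] .
      obtain C' where C': "config A n C'" "past f' \<subseteq> C'" "card C' = card (past f') + length u"
        "hist i (cutc n C' i) (w' @ v')"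
        using path_config[OF pf' _ i w'] u(1) f'(3) unfolding v'_def by metis
      \<comment> \<open>The replay after \<open>f'\<close> has as many events as \<open>C\<close>
        has outside \<open>past f\<close>, and \<open>f\<close> itself is no longer counted.\<close>
      have "card (C' - past f') = length u"
        using C'(2,3) config_finite[OF pf'] by (simp add: card_Diff_subset)
      also have "\<dots> = card (C - past f)"
        using u(2) pf(2) config_finite[OF pf(1)] by (simp add: card_Diff_subset)
      also have "\<dots> < card (C - K)"
        using Kf f(1) fK finC past_self[of f] by (intro psubset_card_mono) blast+
      finally obtain q where "path (fold_rel A n i E co) (?Q `` {cutc n (past f') i}) v' q"
        using less.hyps[OF _ _ C'(1,2) w' C'(4)] f'(1,2) by blast
      moreover have "cutc n (past f') i = Out f' i"
        using cutc_past[OF pf'] f'(2) unfolding ievent_def by blast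
      moreover have "(?Q `` {?b}, ev_act f, ?Q `` {Out f i}) \<in> fold_rel A n i E co"
        using True fi f(2) b(2) unfolding fold_rel_def iproj_rel_def by blast
      ultimately show ?thesis unfolding v using f'(4) path.simps(2) by metis
    next
      case fE: False
      have "f \<in> past f - E" using fE by simp
      \<comment> \<open>A causally minimal event missing from \<open>E\<close> has its strict past
        in \<open>E\<close> and is thus a possible extension. As the algorithm has stopped, a marked
        event \<open>c\<close> must lie strictly below it.\<close>
      then obtain g where g: "g \<in> past f - E" and g_min: "\<And>y. (y, g) \<in> dpred\<^sup>+ \<Longrightarrow> y \<notin> past f - E"
        using wfE_min[OF wf_trancl[OF wf_dpred]] by metis
      have gf: "g \<in> past f" "g \<in> C" using g pf(2) by auto
      have "past g - {g} \<subseteq> E"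
      proof
        fix y assume y: "y \<in> past g - {g}"
        then have "(y, g) \<in> dpred\<^sup>+" unfolding past_def by (auto dest: rtranclD)
        moreover have "y \<in> past f" using y gf(1) past_trans by blast
        ultimately show "y \<in> E" using g_min by blast
      qed
      then have ext: "poss_ext A n E g"
        using poss_extI[OF config_past[OF C gf(2)]] g by blast
      then have "\<not> (\<forall>e'. less (insert g E) (Inr e') (Inr g) \<longrightarrow> e' \<notin> co \<union> coc)"
        using final unfolding alg_final_def eligible_def by auto
      then obtain c where c: "c \<in> past g" "c \<in> co \<union> coc"
        using less_iff[OF poss_ext_closed[OF E ext], of g] by blast
      have cE: "c \<in> E" using c(2) sub by blast
      have cf: "c \<in> past f" "c \<noteq> f" using c(1) gf(1) past_trans fE cE by blast+
      have cC: "c \<in> C" using cf(1) pf(2) by blast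
      have fc: "f \<notin> past c" using cf past_antisym by blast
      have cand_c: "is_cand A n i E co c" and nci: "\<not> ievent i c" if "c \<in> coc"
        using cand[OF that] unfolding is_cand_def by auto
      \<comment> \<open>Marked events are maximal in \<open>E\<close>, so inside
        \<open>past x\<close> only \<open>x\<close> could be marked; but \<open>x\<close> is not in
        \<open>co\<close> and, as an i-event, not in \<open>coc\<close>.\<close>
      have cK: "c \<notin> K"
      proof
        assume "c \<in> K"
        then obtain x where x: "x \<in> E - co" "ievent i x" "c \<in> past x" using K_cases by blast
        then have "c = x" using pst[of x c] c(2) by blast
        then show False using x c(2) nci by blast
      qed
      \<comment> \<open>A cut-off outside \<open>K\<close> would be an i-event above the consumer
        \<open>f\<close>, whereas \<open>c\<close> is strictly below \<open>f\<close>.\<close>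
      have "c \<notin> co"
        using consumer_below[OF C K KC f, of c] cC cK coi[of c] fc unfolding ievent_def by blast
      then have coc: "c \<in> coc" using c(2) by blast
      have Ec: "insert c E = E" using cE by blast
      obtain c' where c': "c' \<in> E" "strong n c' c" "gst A n (past c) = gst A n (past c')"
        "cutc n (past c') i = cutc n (past c) i"
        "{x\<in>E. ievent i x \<and> x \<notin> co \<and> conc x c} \<subseteq> {x\<in>E. ievent i x \<and> x \<notin> co \<and> conc x c'}"
        using cand_c[OF coc] is_cand_iff[of A n E c i co] E Ec by auto
      have pc: "past c \<subseteq> C" using config_past_subset[OF C cC] .
      have c'c: "past c' \<subseteq> past c" "c' \<noteq> c" "c' \<in> past c"
        using c'(2) past_trans unfolding strong_def by blast+
      \<comment> \<open>The shrinking step replaces \<open>past c\<close> by \<open>past c'\<close>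
        but retains \<open>K\<close>. In both \<open>C0\<close> and \<open>K2\<close> the current
        i-condition is still \<open>?b\<close>, so \<open>w\<close> and \<open>v\<close> stay as
        they are.\<close>
      define C0 where "C0 = past c \<union> K"
      define K2 where "K2 = past c' \<union> K"
      have pK: "past y \<subseteq> K" if "y \<in> K" for y using config_past_subset[OF K that] .
      have C0: "config A n C0" "C0 \<subseteq> C"
        unfolding C0_def using pc KC by (auto intro!: config_subset[OF C] dest: past_trans pK)
      have K2: "config A n K2" "K2 \<subseteq> C0"
        using c'c pc KC unfolding K2_def C0_def
        by (auto intro!: config_subset[OF C] dest: past_trans pK)
      have b_free: "?b \<notin> pre d" if "d \<in> C0" for d
        using that config_conflict_free[OF C f(1) _ f(2), of d] C0(2) fc fK unfolding C0_def by blast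
      have bC0: "cutc n L i = ?b" if "config A n L" "K \<subseteq> L" "L \<subseteq> C0" for L
        using cutc_eqI[OF that(1) _ b(2)] conds_mono[OF that(2), of n] bK b_free that(3)
        unfolding cutset_def by blast
      have gst_eq: "gst A n K2 = gst A n C0"
      proof (cases "K \<subseteq> past c")
        case True
        then have "C0 = past c" unfolding C0_def by blast
        \<comment> \<open>Since \<open>c\<close> and \<open>c'\<close> have the same i-condition,
          \<open>past c'\<close> also contains the producer of \<open>?b\<close>, and with it all of
          \<open>K\<close>.\<close>
        then have "cutc n (past c') i = ?b" using c'(4) bC0[OF C0(1)] unfolding C0_def by auto
        then have "?b \<in> conds n (past c')"
          using cutc_in(1)[OF bp_closed_config[OF E c'(1)] i] unfolding cutset_def by auto
        then have "K \<subseteq> past c'" using K_cases past_trans by auto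
        then have "K2 = past c'" unfolding K2_def by blast
        then show ?thesis using c'(3) \<open>C0 = past c\<close> by simp
      next
        case False
        then obtain x where x: "x \<in> E - co" "ievent i x" "K = past x" using K_cases by blast
        have xC: "x \<in> C" using x(3) KC by auto
        have "x \<notin> past c" using False x(3) past_trans by blast
        moreover have "c \<notin> past x" using cK x(3) by blast
        ultimately have "conc x c"
          using config_conflict_free[OF C] pc KC unfolding conc_def x(3) by blast
        then show ?thesis
          using strong_conc_gst[OF C cC xC _ _ c'(2,3)] c'(5) x unfolding K2_def C0_def by blast
      qed
      have "c \<notin> past c'" using c'c past_antisym by blast
      then have "K2 \<subset> C0" using K2(2) cK unfolding K2_def C0_def by auto
      then have card: "card K2 < card C0"
        using psubset_card_mono config_finite[OF C0(1)] by blast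
      have cuts: "cutc n C0 i = ?b" "cutc n K2 i = ?b"
        using bC0[OF C0(1)] bC0[OF K2(1) _ K2(2)] unfolding C0_def K2_def by auto
      obtain u where u: "path (prod_rel A n) (gst A n C0) u (gst A n C)"
        "card C = card C0 + length u" "hist i (cutc n C i) (w @ filter (\<lambda>a. a \<in> acts (A i)) u)"
        using config_path[OF C C0 i, of w] less.prems(4) cuts(1) by metis
      obtain C' where C': "config A n C'" "K2 \<subseteq> C'" "card C' = card K2 + length u"
        "hist i (cutc n C' i) (w @ filter (\<lambda>a. a \<in> acts (A i)) u)"
        using path_config[OF K2(1) _ i, of u _ w] u(1) gst_eq less.prems(4) cuts(2) by metis
      have v: "v = filter (\<lambda>a. a \<in> acts (A i)) u" using hist_unique[OF u(3) less.prems(5)] by simp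
      have KC': "K \<subseteq> C'" using C'(2) unfolding K2_def by blast
      have "card C' < card C" using card u(2) C'(3) by simp
      moreover have "card K \<le> card C'" using KC' card_mono config_finite[OF C'(1)] by blast
      ultimately have "card (C' - K) < card (C - K)"
        using KC KC' config_finite[OF K] by (simp add: card_Diff_subset)
      then show ?thesis
        using less.hyps[OF _ less.prems(1) C'(1) KC' less.prems(4)] C'(4) v by blast
    qed
  qed
qed

lemma finite_pre: "finite (pre e)"
  by (cases e) auto

lemma Tr_fold_complete:
  assumes inv: "alg_inv A n i (E, co, coc)" and final: "alg_final A n (E, co, coc)" and i: "i < n"
  shows "proj (acts (A i)) ` Tr_prod A n \<subseteq> Tr_fold A n i E co"
  unfolding Tr_prod_def Tr_fold_def
proof (rule proj_traces_subset)
  have "finite E" using inv is_bp_closed unfolding alg_inv_def by auto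
  have "fold_rel A n i E co \<subseteq> (\<lambda>(b, e). (fold_eq A n i E co `` {b}, ev_act e, fold_eq A n i E co `` {Out e i}))
      ` (SIGMA b:(\<Union>e\<in>E. pre e). E)"
    unfolding fold_rel_def iproj_rel_def by force
  then show "finite (fold_rel A n i E co)"
    by (rule finite_subset) (simp add: finite_pre \<open>finite E\<close>)
next
  fix u g assume u: "path (prod_rel A n) (prod_init A n) u g"
  have h: "hist i (cutc n {} i) []" using cutc_empty[OF i] hist_Init by metis
  obtain C where C: "config A n C" "hist i (cutc n C i) ([] @ filter (\<lambda>a. a \<in> acts (A i)) u)"
    using path_config[OF config_empty _ i h, of A u g] u unfolding gst_empty by blast
  then show "\<exists>q. path (fold_rel A n i E co) (fold_init A n i E co) (filter (\<lambda>a. a \<in> acts (A i)) u) q"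
    using fold_complete[OF inv final i _ C(1) empty_subsetI h C(2)]
    unfolding fold_init_def cutc_empty[OF i] by simp
qed

section \<open>Termination\<close>

lemma dpred_chain_past:
  assumes "\<And>k. (g k, g (Suc k)) \<in> dpred" "k \<le> l"
  shows "g k \<in> past (g l)"
  using assms(2)
proof (induction rule: dec_induct)
  case (step l)
  then show ?case using assms(1)[of l] unfolding past_def by (auto intro: rtrancl_into_rtrancl)
qed simp

lemma dpred_chain_inj:
  assumes "\<And>k. (g k, g (Suc k)) \<in> dpred"
  shows "inj g"
proof (rule linorder_injI)
  fix k l :: nat assume "k < l"
  then have "g (Suc k) \<in> past (g l)" using dpred_chain_past[of g "Suc k" l] assms by simp
  then have "(g k, g l) \<in> dpred\<^sup>+"
    using assms[of k] unfolding past_def by (auto intro: rtrancl_into_trancl2)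
  then show "g k \<noteq> g l" using dpred_acyclic[of "g k"] by auto
qed

text \<open>Along an infinite causal chain all components that move infinitely often keep learning about
  the chain: synchronisation is symmetric, so a component that influences the chain infinitely
  often is also influenced by it.\<close>

lemma chain_strong:
  assumes chain: "\<And>k. (g k, g (Suc k)) \<in> dpred" and cfg: "\<And>k. config A n (past (g k))"
  shows "\<exists>K. \<forall>k\<ge>K. \<exists>L. \<forall>l\<ge>L. strong n (g k) (g l)"
proof -
  note mono = dpred_chain_past[of g, OF chain]
  have mono': "past (g k) \<subseteq> past (g l)" if "k \<le> l" for k l
    using mono[OF that] past_trans by blast
  define W where "W j = {y. ev_tt y j \<noteq> None \<and> (\<exists>k. y \<in> past (g k))}" for j
  have cover: "\<exists>k. X \<subseteq> past (g k)" if "finite X" "\<And>y. y \<in> X \<Longrightarrow> \<exists>k. y \<in> past (g k)" for X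
    using that
  proof (induction X rule: finite_induct)
    case (insert x X)
    then obtain k k' where "X \<subseteq> past (g k)" "x \<in> past (g k')" by blast
    then have "insert x X \<subseteq> past (g (max k k'))"
      using mono'[of k "max k k'"] mono'[of k' "max k k'"] by auto
    then show ?case by blast
  qed simp
  define J where "J = {j. j < n \<and> infinite (W j)}"
  define V where "V = (\<Union>q\<in>{..<n} - J. W q)"
  have finV: "finite V" unfolding V_def J_def by auto
  have inV: "\<exists>k. y \<in> past (g k)" if "y \<in> V" for y using that unfolding V_def W_def by blast
  have finJ: "finite J" unfolding J_def by simp
  \<comment> \<open>The components in \<open>J1\<close> are those that remain ignorant of some chain
    event; \<open>g m'\<close> is one unknown to all of them. A causal path starting at a late event
    of such a component only passes through conditions of \<open>J1\<close>, since any other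
    component already knows \<open>g m'\<close> and would pass it on when synchronising. So some
    late chain event involves a component of \<open>J1\<close>, although \<open>g m'\<close> is in
    its past.\<close>
  have reaches: "\<exists>y\<in>W j. g m \<in> past y" if jJ: "j \<in> J" for j m
  proof (rule ccontr)
    assume contr: "\<not> ?thesis"
    define J1 where "J1 = {j\<in>J. \<exists>m. \<forall>y\<in>W j. g m \<notin> past y}"
    have jJ1: "j \<in> J1" using contr jJ unfolding J1_def by blast
    have "\<forall>j\<in>J1. \<exists>m. \<forall>y\<in>W j. g m \<notin> past y" unfolding J1_def by blast
    then obtain mf where mf: "\<And>j y. j \<in> J1 \<Longrightarrow> y \<in> W j \<Longrightarrow> g (mf j) \<notin> past y"
      by (auto dest!: bchoice)
    have finJ1: "finite J1" using finJ unfolding J1_def by simp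
    define m' where "m' = Max (mf ` J1)"
    have m': "g m' \<notin> past y" if "j \<in> J1" "y \<in> W j" for j y
    proof
      assume "g m' \<in> past y"
      moreover have "mf j \<le> m'" unfolding m'_def using finJ1 that by simp
      ultimately show False using mf[OF that] mono past_trans by blast
    qed
    have "\<forall>q\<in>J - J1. \<exists>y\<in>W q. g m' \<in> past y" unfolding J1_def by blast
    then obtain u where u: "\<And>q. q \<in> J - J1 \<Longrightarrow> u q \<in> W q \<and> g m' \<in> past (u q)" by metis
    \<comment> \<open>An event outside \<open>past (g p)\<close> is late enough: it is no event of a
      component outside \<open>J\<close>, and on a component in \<open>J - J1\<close> it comes after
      the witness \<open>u q\<close>.\<close>
    have "\<exists>p. V \<union> u ` (J - J1) \<subseteq> past (g p)"
    proof (rule cover)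
      show "finite (V \<union> u ` (J - J1))" using finV finJ by simp
      show "\<exists>k. y \<in> past (g k)" if "y \<in> V \<union> u ` (J - J1)" for y
        using that inV u unfolding W_def by blast
    qed
    then obtain p where p: "V \<subseteq> past (g p)" "\<And>q. q \<in> J - J1 \<Longrightarrow> u q \<in> past (g p)" by blast
    have "infinite (W j)" using jJ unfolding J_def by simp
    then have "\<not> W j \<subseteq> past (g p)" using config_finite[OF cfg] finite_subset by blast
    then obtain y l0 where y: "y \<in> W j" "y \<notin> past (g p)" "y \<in> past (g l0)" unfolding W_def by blast
    define l where "l = max l0 m'"
    have yl: "y \<in> past (g l)" using y(3) mono'[of l0 l] unfolding l_def by auto
    have "z \<in> past (g l) \<longrightarrow> z \<notin> past (g p) \<and> (\<exists>q\<in>J1. ev_tt z q \<noteq> None)" if "(y, z) \<in> dpred\<^sup>*" for z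
      using that
    proof (induction rule: rtrancl_induct)
      case base
      show ?case using y jJ1 unfolding W_def by blast
    next
      case (step z z')
      show ?case
      proof
        assume z': "z' \<in> past (g l)"
        obtain q where q: "Out z q \<in> pre z'" using step.hyps(2) unfolding dpred_def by auto
        have zz': "z \<in> past z'" using pre_Out_past[OF q] .
        then have z: "z \<in> past (g l)" using z' past_trans by blast
        then obtain q1 where zp: "z \<notin> past (g p)" and q1: "q1 \<in> J1" "ev_tt z q1 \<noteq> None"
          using step.IH by blast
        have zq: "ev_tt z q \<noteq> None" using config_pre[OF cfg z' q] by simp
        have z'q: "ev_tt z' q \<noteq> None" and qn: "q < n"
          using wfe_pre(1,2)[OF config_wfe[OF cfg z'] q] by simp_all
        have zW: "z \<in> W q" "z \<in> W q1" using zq q1 z unfolding W_def by blast+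
        have "q \<in> J1"
        proof (rule ccontr)
          assume "q \<notin> J1"
          have "q \<in> J"
          proof (rule ccontr)
            assume "q \<notin> J"
            then have "z \<in> V" using qn zW(1) unfolding V_def by blast
            then show False using p(1) zp by blast
          qed
          then have uq: "u q \<in> W q" "g m' \<in> past (u q)" "u q \<in> past (g p)"
            using u p(2) \<open>q \<notin> J1\<close> by blast+
          \<comment> \<open>A common configuration makes \<open>u q\<close> and \<open>z\<close>,
            both events of component \<open>q\<close>, comparable. As \<open>z\<close> is not below
            \<open>g p\<close>, it comes after \<open>u q\<close> and thus after
            \<open>g m'\<close>.\<close>
          define r where "r = max l p"
          have "u q \<in> past (g r)" "z \<in> past (g r)"
            using uq(3) z mono'[of p r] mono'[of l r] unfolding r_def by auto
          then have "u q \<in> past z \<or> z \<in> past (u q)"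
            using comparable[OF cfg, of "u q" r z q] uq(1) zq unfolding W_def by blast
          moreover have "z \<notin> past (u q)" using uq(3) zp past_trans by blast
          ultimately have "g m' \<in> past z" using uq(2) past_trans by blast
          then show False using m'[OF q1(1) zW(2)] by blast
        qed
        moreover have "z' \<notin> past (g p)" using zz' zp past_trans by blast
        ultimately show "z' \<notin> past (g p) \<and> (\<exists>q\<in>J1. ev_tt z' q \<noteq> None)" using z'q by blast
      qed
    qed
    then obtain q where "q \<in> J1" "ev_tt (g l) q \<noteq> None"
      using yl past_self[of "g l"] unfolding past_def by blast
    then have "g m' \<notin> past (g l)" using m'[of q "g l"] past_self[of "g l"] unfolding W_def by blast
    then show False using mono[of m' l] unfolding l_def by simp
  qed
  \<comment> \<open>From \<open>K\<close> on, components outside \<open>J\<close> make no further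
    moves below the chain, so a condition that is new in a later cut belongs to a component in
    \<open>J\<close>.\<close>
  obtain K where K: "V \<subseteq> past (g K)" using cover[OF finV] inV by blast
  have "\<exists>L. \<forall>l\<ge>L. strong n (g k) (g l)" if k: "k \<ge> K" for k
  proof -
    \<comment> \<open>These finitely many conditions are all consumed below some \<open>g m\<close>.
      By \<open>reaches\<close>, each component in \<open>J\<close> has an event above
      \<open>g m\<close>; once all these events are below \<open>g l\<close>, every new condition of
      its cut lies above every consumed one.\<close>
    define B where "B = {b \<in> cutset n (past (g k)). \<exists>l. \<exists>x\<in>past (g l). b \<in> pre x}"
    have "\<forall>b\<in>B. \<exists>x. b \<in> pre x \<and> (\<exists>l. x \<in> past (g l))" unfolding B_def by blast
    then obtain \<xi> where \<xi>: "\<And>b. b \<in> B \<Longrightarrow> b \<in> pre (\<xi> b) \<and> (\<exists>l. \<xi> b \<in> past (g l))" by metis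
    have "b \<in> (\<lambda>j. cutc n (past (g k)) j) ` {..<n}" if "b \<in> cutset n (past (g k))" for b
      using cutc_eqI[OF cfg that refl] cutset_comp_less[OF cfg that] by (metis imageI lessThan_iff)
    then have "finite (cutset n (past (g k)))"
      using finite_subset[of "cutset n (past (g k))" "(\<lambda>j. cutc n (past (g k)) j) ` {..<n}"] by blast
    then have "finite B" unfolding B_def by simp
    then obtain m where m: "\<xi> ` B \<subseteq> past (g m)" using cover[of "\<xi> ` B"] \<xi> by blast
    have "\<forall>j\<in>J. \<exists>y. y \<in> W j \<and> g m \<in> past y" using reaches by blast
    then obtain y where y: "\<And>j. j \<in> J \<Longrightarrow> y j \<in> W j \<and> g m \<in> past (y j)" by (auto dest!: bchoice)
    obtain L where L: "y ` J \<subseteq> past (g L)" using cover[of "y ` J"] finJ y unfolding W_def by blast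
    have "strong n (g k) (g l)" if l: "l \<ge> max L (Suc k)" for l
      unfolding strong_def
    proof (intro conjI ballI)
      show "g k \<in> past (g l)" using mono l by simp
      show "g k \<noteq> g l" using injD[OF dpred_chain_inj[of g, OF chain], of k l] l by auto
      fix b b'
      assume b: "b \<in> cutset n (past (g l)) - cutset n (past (g k))"
        and b': "b' \<in> cutset n (past (g k)) - cutset n (past (g l))"
      have "b' \<in> conds n (past (g l))"
        using b' conds_mono[OF mono'[of k l], of n] l unfolding cutset_def by auto
      then have "b' \<in> B" using b' unfolding B_def cutset_def by blast
      then have x: "b' \<in> pre (\<xi> b')" "\<xi> b' \<in> past (g m)" using \<xi> m by blast+
      define j where "j = comp b"
      have jn: "j < n" using cutset_comp_less[OF cfg] b unfolding j_def by blast
      have bl: "cutc n (past (g l)) j = b" using cutc_eqI[OF cfg, of b] b unfolding j_def by blast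
      have "j \<in> J"
      proof (rule ccontr)
        assume "j \<notin> J"
        then have Wj: "W j \<subseteq> past (g k)" using jn K mono'[OF k] unfolding V_def by blast
        define c where "c = cutc n (past (g k)) j"
        have c: "c \<in> cutset n (past (g k))" "comp c = j" using cutc_in[OF cfg jn] unfolding c_def by auto
        have "c \<notin> pre z" if z: "z \<in> past (g l)" for z
        proof
          assume cz: "c \<in> pre z"
          then have "z \<in> W j" using wfe_pre(2)[OF config_wfe[OF cfg z] cz] c(2) z unfolding W_def by blast
          then show False using Wj c(1) cz unfolding cutset_def by blast
        qed
        moreover have "c \<in> conds n (past (g l))"
          using c(1) conds_mono[OF mono'[of k l], of n] l unfolding cutset_def by auto
        ultimately have "c \<in> cutset n (past (g l))" unfolding cutset_def by blast
        then have "b = c" using cutc_eqI[OF cfg _ c(2)] bl by blast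
        then show False using c(1) b by blast
      qed
      then have yj: "ev_tt (y j) j \<noteq> None" "g m \<in> past (y j)" "y j \<in> past (g l)"
        using y L mono'[of L l] l unfolding W_def by auto
      obtain z where "cutc n (past (g l)) j = Out z j" "y j \<in> past z"
        using cutc_above[OF cfg yj(3,1)] by blast
      then have "b = Out z j" "\<xi> b' \<in> past z" using bl x(2) yj(2) past_trans by (simp, blast)
      then show "\<exists>x y j. b' \<in> pre x \<and> x \<in> past y \<and> b = Out y j" using x(1) by blast
    qed
    then show ?thesis by blast
  qed
  then show ?thesis by blast
qed

section \<open>Finiteness of global states and of the events over finitely many conditions\<close>

lemma finite_gst:
  assumes wf: "\<forall>j<n. lts_wf (A j)"
  shows "finite {gst A n C | C. config A n C}"
proof -
  let ?G = "{gst A n C | C. config A n C}"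
  have "clab A b \<in> states (A (comp b))" if C: "config A n C" and b: "b \<in> cutset n C" for C b
  proof -
    have j: "lts_wf (A (comp b))" using wf cutset_comp_less[OF C b] by blast
    show ?thesis
    proof (cases b)
      case (Init j)
      then show ?thesis using j unfolding lts_wf_def by simp
    next
      case (Out e j)
      then have e: "e \<in> C" "ev_tt e j \<noteq> None" using b unfolding cutset_def by auto
      have w: "wfe A n e" using config_wfe[OF C e(1)] .
      have "the (ev_tt e j) \<in> trans (A j)"
        using w e(2) wfe_tt_less[OF w e(2)] unfolding wfe_def gtrans_def by (metis option.sel)
      then have "snd (the (ev_tt e j)) \<in> states (A j)"
        using \<open>lts_wf (A (comp b))\<close> Out unfolding lts_wf_def by (auto simp: mem_Times_iff)
      then show ?thesis using Out by simp
    qed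
  qed
  then have st: "gst A n C j \<in> states (A j)" if "config A n C" "j < n" for C j
    using that cutc_in[OF that] unfolding gst_def by fastforce
  have "(\<lambda>g. map g [0..<n]) ` ?G \<subseteq> {xs. set xs \<subseteq> (\<Union>j<n. states (A j)) \<and> length xs = n}"
    using st by fastforce
  moreover have "finite (\<Union>j<n. states (A j))" using wf unfolding lts_wf_def by blast
  ultimately have "finite ((\<lambda>g. map g [0..<n]) ` ?G)"
    using finite_lists_length_eq finite_subset by blast
  moreover have "inj_on (\<lambda>g. map g [0..<n]) ?G"
    unfolding inj_on_def by (auto simp: gst_def fun_eq_iff)
  ultimately show ?thesis using finite_imageD by blast
qed

lemma finite_events_over:
  assumes wf: "\<forall>j<n. lts_wf (A j)" and X: "finite X"
  shows "finite {e. wfe A n e \<and> pre e \<subseteq> X}"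
proof -
  define Acts where "Acts = (\<Union>j<n. acts (A j))"
  define T where "T = insert None (Some ` (\<Union>j<n. trans (A j)))"
  define TT where "TT = {tt. \<forall>j. (j \<in> {..<n} \<longrightarrow> tt j \<in> T) \<and> (j \<notin> {..<n} \<longrightarrow> tt j = None)}"
  have "finite Acts" unfolding Acts_def using wf unfolding lts_wf_def by blast
  have "finite (trans (A j))" if "j < n" for j
    using wf that unfolding lts_wf_def by (meson finite_SigmaI finite_subset)
  then have "finite T" unfolding T_def by auto
  then have "finite TT" unfolding TT_def by (intro finite_set_of_finite_funs) auto
  have "{e. wfe A n e \<and> pre e \<subseteq> X} \<subseteq> (\<lambda>(a, tt, M). Ev a tt (Abs_fset M)) ` (Acts \<times> TT \<times> Pow X)"
  proof
    fix e assume "e \<in> {e. wfe A n e \<and> pre e \<subseteq> X}"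
    then have w: "wfe A n e" "pre e \<subseteq> X" by auto
    obtain a tt M where e: "e = Ev a tt M" by (cases e)
    have gt: "gtrans A n a tt" using w(1) unfolding e wfe_def by simp
    have loc: "a \<in> acts (A j) \<and> (\<exists>t. tt j = Some t \<and> t \<in> trans (A j)) \<or> tt j = None" if "j < n" for j
      using gt that unfolding gtrans_def by meson
    obtain j where j: "j < n" "tt j \<noteq> None" using gt unfolding gtrans_def by blast
    then have "a \<in> Acts" using loc[OF j(1)] unfolding Acts_def by auto
    moreover have "tt \<in> TT"
    proof -
      have "tt j \<in> T" if "j < n" for j using loc[OF that] that unfolding T_def by auto
      moreover have "tt j = None" if "\<not> j < n" for j using gt that unfolding gtrans_def by simp
      ultimately show ?thesis unfolding TT_def by simp
    qed
    ultimately show "e \<in> (\<lambda>(a, tt, M). Ev a tt (Abs_fset M)) ` (Acts \<times> TT \<times> Pow X)"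
      using w(2) unfolding e by (intro image_eqI[of _ _ "(a, tt, fset M)"]) (auto simp: fset_inverse)
  qed
  then show ?thesis
    using finite_subset \<open>finite Acts\<close> \<open>finite TT\<close> X by (meson finite_SigmaI finite_Pow_iff finite_imageI)
qed

text \<open>Koenig's lemma cannot be applied to \<open>dpred\<close> directly: an event may have
  infinitely many direct successors whose other inputs come from ever later events. If only the
  latest cause counts as parent, all inputs of a child exist once the parent has been added, and
  \<open>finite_events_over\<close> bounds the number of children.\<close>

lemma infinite_causal_chain:
  fixes e :: "nat \<Rightarrow> ('s, 'a) event"
  assumes wf: "\<forall>j<n. lts_wf (A j)" and inj: "inj e" and cl: "\<And>k. bp_closed A n (e ` {..<k})"
  obtains s where "\<And>j. (e (s j), e (s (Suc j))) \<in> dpred" "strict_mono s"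
proof -
  have wfe: "wfe A n (e k)" for k using bp_closed_wfe[OF cl[of "Suc k"]] by simp
  have earlier: "k < m" if "(e k, e m) \<in> dpred" for k m
  proof -
    have "e k \<in> past (e m)" "e k \<noteq> e m"
      using that pre_Out_past pre_Out_neq unfolding dpred_def by blast+
    moreover have "past (e m) \<subseteq> e ` {..<Suc m}" using bp_closed_past[OF cl[of "Suc m"], of "e m"] by simp
    ultimately obtain k' where "k' < Suc m" "e k = e k'" by blast
    then show ?thesis using injD[OF inj] \<open>e k \<noteq> e m\<close> by (metis less_SucE)
  qed
  have preds: "b = Init (comp b) \<and> comp b < n \<or> (\<exists>k j. b = Out (e k) j \<and> ev_tt (e k) j \<noteq> None \<and> (e k, e m) \<in> dpred)"
    if b: "b \<in> pre (e m)" for b m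
  proof -
    have "b \<in> conds n (e ` {..<Suc m})" using bp_closed_pre[OF cl[of "Suc m"], of "e m" b] b by simp
    then show ?thesis using b unfolding dpred_def by (cases b) auto
  qed
  have fin: "finite {m. pre (e m) \<subseteq> conds n (e ` {..<k})}" for k
  proof -
    have "post (e m) \<subseteq> Out (e m) ` {..<n}" for m
      using wfe_tt_less[OF wfe] unfolding post_def by blast
    then have "finite (post (e m))" for m using finite_subset by blast
    then have "finite (conds n (e ` {..<k}))" unfolding conds_def init_mark_def by auto
    then have "finite {x. wfe A n x \<and> pre x \<subseteq> conds n (e ` {..<k})}" using finite_events_over[OF wf] by blast
    then have "finite (e -` {x. wfe A n x \<and> pre x \<subseteq> conds n (e ` {..<k})})" using inj finite_vimageI by blast
    then show ?thesis using wfe by (simp add: vimage_def)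
  qed
  \<comment> \<open>the parent of an event is its latest direct cause, which makes the tree finitely branching\<close>
  define r where "r = {(m, k). (e k, e m) \<in> dpred \<and> pre (e m) \<subseteq> conds n (e ` {..<Suc k})}"
  have "\<not> wf r"
  proof
    assume wfr: "wf r"
    have findesc: "finite {m. (m, k) \<in> r\<^sup>*}" for k
    proof (induction k rule: wf_induct_rule[OF wfr])
      case (1 k)
      have "finite {k'. (k', k) \<in> r}" using finite_subset[OF _ fin[of "Suc k"]] unfolding r_def by auto
      then have "finite (insert k (\<Union>k'\<in>{k'. (k', k) \<in> r}. {m. (m, k') \<in> r\<^sup>*}))" using 1 by auto
      moreover have "{m. (m, k) \<in> r\<^sup>*} \<subseteq> insert k (\<Union>k'\<in>{k'. (k', k) \<in> r}. {m. (m, k') \<in> r\<^sup>*})"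
        by (auto elim: rtranclE)
      ultimately show ?case using finite_subset by blast
    qed
    \<comment> \<open>Following parents ends at a root, an event all of whose inputs are initial;
      there are finitely many roots.\<close>
    have "\<exists>k. pre (e k) \<subseteq> conds n (e ` {..<0}) \<and> (m, k) \<in> r\<^sup>*" for m
    proof (induction m rule: less_induct)
      case (less m)
      define P where "P = {k. (e k, e m) \<in> dpred}"
      have finP: "finite P" using finite_subset[of P "{..<m}"] earlier unfolding P_def by auto
      show ?case
      proof (cases "P = {}")
        case True
        have "b \<in> conds n {}" if "b \<in> pre (e m)" for b
          using preds[OF that] True unfolding P_def by (metis Init_in_conds empty_Collect_eq)
        then show ?thesis by (intro exI[of _ m]) auto
      next
        case False
        define k where "k = Max P"
        have k: "k \<in> P" "\<And>k'. k' \<in> P \<Longrightarrow> k' \<le> k" using finP False unfolding k_def by auto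
        have "b \<in> conds n (e ` {..<Suc k})" if "b \<in> pre (e m)" for b
          using preds[OF that]
        proof
          assume "b = Init (comp b) \<and> comp b < n"
          then show ?thesis by (metis Init_in_conds)
        next
          assume "\<exists>k j. b = Out (e k) j \<and> ev_tt (e k) j \<noteq> None \<and> (e k, e m) \<in> dpred"
          then obtain k' j where k': "b = Out (e k') j" "ev_tt (e k') j \<noteq> None" "k' \<in> P"
            unfolding P_def by blast
          then show ?thesis using k(2)[of k'] by simp
        qed
        then have "(m, k) \<in> r" using k(1) unfolding r_def P_def by blast
        moreover have "k < m" using k(1) earlier unfolding P_def by blast
        ultimately show ?thesis using less[of k] by (meson converse_rtrancl_into_rtrancl)
      qed
    qed
    then have "(UNIV :: nat set) \<subseteq> (\<Union>k\<in>{k. pre (e k) \<subseteq> conds n (e ` {..<0})}. {m. (m, k) \<in> r\<^sup>*})"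
      by blast
    moreover have "finite (\<Union>k\<in>{k. pre (e k) \<subseteq> conds n (e ` {..<0})}. {m. (m, k) \<in> r\<^sup>*})"
      using fin[of 0] findesc by blast
    ultimately have "finite (UNIV :: nat set)" by (rule finite_subset)
    then show False by simp
  qed
  then obtain s where s: "\<And>j. (s (Suc j), s j) \<in> r" unfolding wf_iff_no_infinite_down_chain by blast
  then have "(e (s j), e (s (Suc j))) \<in> dpred" for j unfolding r_def by blast
  then show ?thesis using that[of s] earlier by (simp add: strict_mono_Suc_iff)
qed

lemma no_infinite_run:
  assumes wf: "\<forall>j<n. lts_wf (A j)" and i: "i < n"
    and start: "f 0 = alg_start" and step: "\<And>k. alg_step A n i (f k) (f (Suc k))"
  shows False
proof -
  define E co coc where "E k = fst (f k)" and "co k = fst (snd (f k))" and "coc k = snd (snd (f k))" for k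
  have fk: "f k = (E k, co k, coc k)" for k unfolding E_def co_def coc_def by simp
  have inv: "alg_inv A n i (E k, co k, coc k)" for k
  proof (induction k)
    case 0
    show ?case using start alg_inv_start[of A n i] unfolding fk by simp
  next
    case (Suc k)
    then show ?case using alg_inv_step step[of k] unfolding fk by blast
  qed
  have bp: "bp_closed A n (E k)" for k
    using inv[of k] is_bp_closed unfolding alg_inv_def by auto
  have past_free: "x = y" if "y \<in> E k" "x \<in> past y" "x \<in> co k \<union> coc k" for x y k
    using inv[of k] that unfolding alg_inv_def by auto
  have inj_gst: "inj_on (\<lambda>e. gst A n (past e)) {e\<in>E k - co k. ievent i e}" for k
    using inv[of k] unfolding alg_inv_def by auto
  define S where "S k e \<longleftrightarrow> E (Suc k) = insert e (E k) \<and> eligible A n (E k, co k, coc k) e \<and>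
    (is_cutoff A n i (E k) e \<and> co (Suc k) = insert e (co k) \<and> coc (Suc k) = coc k \<or>
     \<not> is_cutoff A n i (E k) e \<and> is_cand A n i (E k) (co k) e \<and>
       co (Suc k) = co k \<and> coc (Suc k) = insert e (coc k) \<or>
     \<not> is_cutoff A n i (E k) e \<and> \<not> is_cand A n i (E k) (co k) e \<and> co (Suc k) = co k \<and>
       coc (Suc k) = coc k - {ec \<in> coc k. frees A n i (E k) (co k) e ec})" for k e
  have "\<exists>e. S k e" for k
    unfolding S_def by (rule alg_step_cases[OF step[of k, unfolded fk]]) auto
  then obtain e where e: "\<And>k. S k (e k)" by metis
  have E_Suc: "E (Suc k) = insert (e k) (E k)" and elig: "eligible A n (E k, co k, coc k) (e k)" for k
    using e[of k] unfolding S_def by simp_all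
  note cases = e[unfolded S_def, THEN conjunct2, THEN conjunct2]
  have new: "e k \<notin> E k" for k using elig[of k] unfolding eligible_def poss_ext_def by blast
  have E_eq: "E k = e ` {..<k}" for k
  proof (induction k)
    case 0
    show ?case using start unfolding fk alg_start_def by simp
  next
    case (Suc k)
    then show ?case unfolding E_Suc by (simp add: lessThan_Suc)
  qed
  have inj: "inj e"
  proof (rule linorder_injI)
    fix k l :: nat assume "k < l"
    then show "e k \<noteq> e l" using new[of l] unfolding E_eq by (metis imageI lessThan_iff)
  qed
  have E_mono: "E k \<subseteq> E l" if "k \<le> l" for k l unfolding E_eq using that by auto
  have co_new: "co (Suc k) \<subseteq> insert (e k) (co k)" and co_mono1: "co k \<subseteq> co (Suc k)" for k
    using cases[of k] by auto
  have co_mono: "co k \<subseteq> co l" if "k \<le> l" for k l using lift_Suc_mono_le[of co, OF co_mono1 that] .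
  have never_co: "x \<notin> co l" if x: "x \<in> E k" "x \<notin> co k" for x k l
  proof (cases "k \<le> l")
    case True
    then show ?thesis
    proof (induction rule: dec_induct)
      case base
      show ?case using x(2) .
    next
      case (step l)
      have "x \<noteq> e l" using new[of l] E_mono[OF step.hyps(1)] x(1) by blast
      then show ?case using step.IH co_new[of l] by blast
    qed
  next
    case False
    then show ?thesis using co_mono[of l k] x(2) by auto
  qed
  \<comment> \<open>Whether an event is a cut-off is settled when it is added. The remaining
    i-events have distinct global states at all times, which makes \<open>F\<close> finite.\<close>
  define F where "F = {x \<in> range e. ievent i x \<and> (\<forall>k. x \<notin> co k)}"
  have "inj_on (\<lambda>x. gst A n (past x)) F"
  proof (rule inj_onI)
    fix x y assume x: "x \<in> F" and y: "y \<in> F" and eq: "gst A n (past x) = gst A n (past y)"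
    then obtain k l where kl: "x = e k" "y = e l" unfolding F_def by blast
    define m where "m = Suc (max k l)"
    have "x \<in> E m" "y \<in> E m" unfolding kl E_eq m_def by auto
    then show "x = y" using inj_onD[OF inj_gst[of m] eq] x y unfolding F_def by blast
  qed
  moreover have "(\<lambda>x. gst A n (past x)) ` F \<subseteq> {gst A n C | C. config A n C}"
  proof
    fix s assume "s \<in> (\<lambda>x. gst A n (past x)) ` F"
    then obtain k where "s = gst A n (past (e k))" unfolding F_def by blast
    moreover have "config A n (past (e k))" using bp_closed_config[OF bp[of "Suc k"]] E_Suc by blast
    ultimately show "s \<in> {gst A n C | C. config A n C}" by blast
  qed
  ultimately have finF: "finite F"
    using inj_on_finite[OF _ _ finite_gst[OF wf], of _ F] by simp
  have "finite (e -` F)" using finite_vimageI[OF finF inj] .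
  \<comment> \<open>From \<open>T\<close> on all of \<open>F\<close> is present, so the sets of
    concurrent i-events in candidate tests no longer change.\<close>
  then obtain T where T: "\<And>k. e k \<in> F \<Longrightarrow> k < T"
    unfolding finite_nat_set_iff_bounded by auto
  have F_eq: "{x\<in>E t. ievent i x \<and> x \<notin> co t} = F" if "t \<ge> T" for t
  proof
    show "{x\<in>E t. ievent i x \<and> x \<notin> co t} \<subseteq> F"
      using never_co[of _ t] unfolding F_def E_eq by blast
    show "F \<subseteq> {x\<in>E t. ievent i x \<and> x \<notin> co t}"
    proof
      fix x assume x: "x \<in> F"
      then obtain k where k: "x = e k" unfolding F_def by blast
      then have "x \<in> E t" using T[of k] x that unfolding E_eq by auto
      then show "x \<in> {x\<in>E t. ievent i x \<and> x \<notin> co t}" using x unfolding F_def by blast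
    qed
  qed
  obtain s where s: "\<And>j. (e (s j), e (s (Suc j))) \<in> dpred" and smono: "strict_mono s"
    using infinite_causal_chain[OF wf inj bp[unfolded E_eq]] by metis
  define g where "g j = e (s j)" for j
  have chain: "(g j, g (Suc j)) \<in> dpred" for j unfolding g_def using s .
  have g_E: "g j \<in> E t" if "s j < t" for j t unfolding g_def E_eq using that by auto
  have cfg: "config A n (past (g j))" for j using bp_closed_config[OF bp g_E[of j "Suc (s j)"]] by simp
  have g_inj: "inj g" using dpred_chain_inj[of g, OF chain] .
  \<comment> \<open>A cut-off in the history of the chain would have a further chain event above it,
    although marked events are maximal.\<close>
  have not_co: "x \<notin> co k" if x: "x \<in> past (g j)" for x j k
  proof
    assume "x \<in> co k"
    define m where "m = max k (Suc (s (Suc j)))"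
    have 1: "x \<in> co m \<union> coc m" using \<open>x \<in> co k\<close> co_mono[of k m] unfolding m_def by auto
    have gs: "g j \<in> past (g (Suc j))" using dpred_chain_past[of g j "Suc j", OF chain] by simp
    have "x \<in> past (g (Suc j))" using x gs past_trans by blast
    then have "x = g (Suc j)" using past_free[OF g_E _ 1] unfolding m_def by auto
    then have "g j = g (Suc j)" using x gs past_antisym by blast
    then show False using injD[OF g_inj, of j "Suc j"] by simp
  qed
  have past_F: "x \<in> F" if x: "x \<in> past (g j)" "ievent i x" for x j
  proof -
    have "x \<in> E (Suc (s j))" using bp_closed_past[OF bp g_E[of j "Suc (s j)"]] x(1) by auto
    then show ?thesis using not_co[OF x(1)] x(2) unfolding F_def E_eq by blast
  qed
  have non_i: "finite {j. ievent i (g j)}"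
  proof -
    have "{j. ievent i (g j)} \<subseteq> g -` F" using past_F past_self by blast
    then show ?thesis using finite_vimageI[OF finF g_inj] finite_subset by blast
  qed
  have "\<exists>K. \<forall>k\<ge>K. \<exists>L. \<forall>l\<ge>L. strong n (g k) (g l)"
    by (rule chain_strong[of g A n, OF chain cfg])
  then obtain K where K: "\<forall>k\<ge>K. \<exists>L. \<forall>l\<ge>L. strong n (g k) (g l)" ..
  define X where "X = {j. j \<ge> K \<and> j \<ge> T \<and> \<not> ievent i (g j)}"
  have "UNIV = X \<union> {..<K} \<union> {..<T} \<union> {j. ievent i (g j)}" unfolding X_def by auto
  then have infX: "infinite X" using non_i by (metis finite_UnI finite_lessThan infinite_UNIV_nat)
  \<comment> \<open>These are the data that a candidate must share with its strong cause; equal sets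
    of concurrent events meet the required inclusion.\<close>
  define lbl where "lbl j = (gst A n (past (g j)), cutc n (past (g j)) i, {x\<in>F. conc x (g j)})" for j
  have "lbl ` X \<subseteq> {gst A n C | C. config A n C} \<times> insert (Init i) ((\<lambda>x. Out x i) ` F) \<times> Pow F"
  proof
    fix v assume "v \<in> lbl ` X"
    then obtain j where v: "v = lbl j" by blast
    have c: "cutc n (past (g j)) i \<in> cutset n (past (g j))" "comp (cutc n (past (g j)) i) = i"
      using cutc_in[OF cfg i] by auto
    have "cutc n (past (g j)) i \<in> insert (Init i) ((\<lambda>x. Out x i) ` F)"
    proof (cases "cutc n (past (g j)) i")
      case (Init k)
      then show ?thesis using c(2) by simp
    next
      case (Out x k)
      then have "x \<in> past (g j)" "ievent i x" using c unfolding cutset_def ievent_def by auto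
      then show ?thesis using past_F Out c(2) by auto
    qed
    then show "v \<in> {gst A n C | C. config A n C} \<times> insert (Init i) ((\<lambda>x. Out x i) ` F) \<times> Pow F"
      using cfg[of j] unfolding v lbl_def by auto
  qed
  moreover have "finite ({gst A n C | C. config A n C} \<times> insert (Init i) ((\<lambda>x. Out x i) ` F) \<times> Pow F)"
    using finite_gst[OF wf] finF by simp
  ultimately have "finite (lbl ` X)" by (rule finite_subset)
  from pigeonhole_infinite[OF infX this] obtain k where k: "k \<in> X" "infinite {j\<in>X. lbl j = lbl k}" by blast
  have "k \<ge> K" using k(1) unfolding X_def by simp
  with K obtain L where L: "\<forall>l\<ge>L. strong n (g k) (g l)" by blast
  obtain l where l: "l > max L k" "l \<in> X" "lbl l = lbl k"
    using k(2) unfolding infinite_nat_iff_unbounded by blast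
  have sl: "s l \<ge> T" using strict_mono_imp_increasing[OF smono, of l] l(2) unfolding X_def by auto
  have skl: "s k < s l" using strict_monoD[OF smono, of k l] l(1) by simp
  \<comment> \<open>At \<open>t = s l\<close> this is the test before \<open>g l\<close> is added;
    later the event is already in the process.\<close>
  have cand: "is_cand A n i (E t) (co t) (g l)" if t: "t \<ge> s l" for t
  proof -
    have ins: "bp_closed A n (insert (g l) (E t))"
    proof (cases "t = s l")
      case True
      then show ?thesis using bp[of "Suc t"] E_Suc[of t] unfolding g_def by simp
    next
      case False
      then have "g l \<in> E t" using g_E t by simp
      then show ?thesis using bp[of t] by (simp add: insert_absorb)
    qed
    have Con: "{x\<in>E t. ievent i x \<and> x \<notin> co t \<and> conc x y} = {x\<in>F. conc x y}" for y
      using F_eq[of t] t sl by auto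
    show ?thesis
      unfolding is_cand_iff[OF bp ins] Con
    proof (intro conjI bexI[of _ "g k"])
      show "\<not> ievent i (g l)" using l(2) unfolding X_def by blast
      show "strong n (g k) (g l)" using L l(1) by simp
      show "g k \<in> E t" using g_E skl t by simp
    qed (use l(3) in \<open>auto simp: lbl_def\<close>)
  qed
  \<comment> \<open>As \<open>g l\<close> is no i-event it is not a cut-off, so it enters
    \<open>coc\<close> when it is added; remaining a candidate, it is never freed.\<close>
  have "g l \<in> coc m" if "m \<ge> Suc (s l)" for m
    using that
  proof (induction rule: dec_induct)
    case base
    have "\<not> is_cutoff A n i (E (s l)) (e (s l))"
      using l(2) unfolding is_cutoff_def X_def g_def by blast
    then show ?case using cases[of "s l"] cand[of "s l"] unfolding g_def by auto
  next
    case (step m)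
    have "\<not> frees A n i (E m) (co m) (e m) (g l)" if "co (Suc m) = co m"
      using cand[of "Suc m"] step.hyps that unfolding frees_def E_Suc by auto
    then show ?case using cases[of m] step.IH by auto
  qed
  \<comment> \<open>When \<open>g (Suc l)\<close> is added, \<open>g l\<close> is in its past and
    still marked, which contradicts the maximality of marked events.\<close>
  then have "g l \<in> coc (Suc (s (Suc l)))" using strict_monoD[OF smono, of l "Suc l"] by simp
  moreover have "g l \<in> past (g (Suc l))" using dpred_chain_past[of g l "Suc l", OF chain] by simp
  ultimately have "g l = g (Suc l)" using past_free[OF g_E[of "Suc l" "Suc (s (Suc l))"]] by blast
  then show False using injD[OF g_inj, of l "Suc l"] by simp
qed

theorem theorem2:
  fixes A :: "nat \<Rightarrow> ('s, 'a) lts" and n i :: nat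
  assumes "\<forall>j<n. lts_wf (A j)"
    and "i < n"
  shows "\<not> (\<exists>f. f 0 = alg_start \<and> (\<forall>k. alg_step A n i (f k) (f (Suc k))))
       \<and> (\<forall>E co coc. (alg_step A n i)\<^sup>*\<^sup>* alg_start (E, co, coc) \<and> alg_final A n (E, co, coc)
            \<longrightarrow> finite E \<and> is_bp A n E
                \<and> Tr_fold A n i E co = proj (acts (A i)) ` Tr_prod A n)"
proof (intro conjI allI impI)
  show "\<not> (\<exists>f. f 0 = alg_start \<and> (\<forall>k. alg_step A n i (f k) (f (Suc k))))"
    using no_infinite_run[OF assms] by blast
next
  fix E co coc
  assume run: "(alg_step A n i)\<^sup>*\<^sup>* alg_start (E, co, coc) \<and> alg_final A n (E, co, coc)"
  then have inv: "alg_inv A n i (E, co, coc)" and final: "alg_final A n (E, co, coc)"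
    using alg_inv_reachable by blast+
  show bp: "is_bp A n E" using inv unfolding alg_inv_def by simp
  then show "finite E" using is_bp_closed by blast
  have co: "co \<subseteq> E" "\<And>e. e \<in> co \<Longrightarrow> ievent i e" using inv unfolding alg_inv_def by auto
  show "Tr_fold A n i E co = proj (acts (A i)) ` Tr_prod A n"
    using Tr_fold_sound[OF _ co assms(2), of A] Tr_fold_complete[OF inv final assms(2)]
      is_bp_closed[OF bp] by blast
qed

end
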